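(* Let $(A,\circ)=\{x^{\circ i}\mid i\in\mathbb{Z}\}$ be an infinite cyclic group with generator $x$. If $A=(A,\cdot,\circ)$ is a skew brace, then the additive operation $\cdot$ is given by one of the following three formulas (holding for all $i,j\in\mathbb{Z}$): $$x^{\circ i}\cdot x^{\circ j}=x^{\circ(i+j)},$$ $$x^{\circ i}\cdot x^{\circ j}=x^{\circ(i+(-1)^i j)},$$ $$x^{\circ i}\cdot x^{\circ j}=x^{\circ(j+(-1)^j i)}.$$
   Context: A skew brace (meaning skew left brace) is a set $A$ with two group structures $(A,\cdot)$ (the additive group) and $(A,\circ)$ (the multiplicative group) such that $a\circ(b\cdot c)=(a\circ b)\cdot a^{-1}\cdot(a\circ c)$ for all $a,b,c\in A$, where $a^{-1}$ is the inverse of $a$ in $(A,\cdot)$. The notation $x^{\circ i}$ denotes the $i$-th power of $x$ in the group $(A,\circ)$. *)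

theory Defs
  imports "HOL-Algebra.Group"
begin

text \<open>
  A skew left brace: \<open>G\<close> is the additive group (not necessarily abelian, written
  multiplicatively) and \<open>M\<close> the multiplicative group \<open>(A, \<circ>)\<close>, both on the same underlying set.
\<close>

locale skew_brace = additive: group G + multiplicative: group M
  for G :: "('a, 'b) monoid_scheme" and M :: "('a, 'c) monoid_scheme" +
  assumes same_carrier: "carrier G = carrier M"
    and brace_identity:
      "\<lbrakk>a \<in> carrier G; b \<in> carrier G; c \<in> carrier G\<rbrakk> \<Longrightarrow>
        a \<otimes>\<^bsub>M\<^esub> (b \<otimes>\<^bsub>G\<^esub> c) =
        ((a \<otimes>\<^bsub>M\<^esub> b) \<otimes>\<^bsub>G\<^esub> inv\<^bsub>G\<^esub> a) \<otimes>\<^bsub>G\<^esub> (a \<otimes>\<^bsub>M\<^esub> c)"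

end

theory Submission
  imports Defs "HOL-Algebra.Multiplicative_Group" "HOL-Computational_Algebra.Polynomial"
    "HOL-Computational_Algebra.Primes"
begin

text \<open>
  Writing \<open>i\<close> for the power \<open>x\<^sup>i\<close> turns the multiplicative group into \<open>(\<int>, +)\<close> and the additive
  operation into a group operation \<open>\<star>\<close> on \<open>\<int>\<close> with neutral element \<open>0\<close>. The brace identity says
  that \<open>lam i j = iv i \<star> (i + j)\<close> is an action of \<open>(\<int>, +)\<close> by automorphisms of \<open>(\<int>, \<star>)\<close>.
  As \<open>i \<star> j = i + lam (- i) j\<close>, the single automorphism \<open>lam 1\<close> determines \<open>\<star>\<close>.

  The proof has three parts. The translations \<open>n \<mapsto> j + n\<close> and the powers of \<open>lam 1\<close> lie in the
  holomorph of \<open>(\<int>, \<star>)\<close>, and together they form a group that is a product of two abelian subgroups.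
  Ito's commutator argument for such products, expressed in the brace, shows that the elements
  \<open>a \<star> iv (lam k a)\<close> commute with each other (\<open>defects_commute\<close>). They generate an abelian normal
  subgroup \<open>D\<close> of \<open>(\<int>, \<star>)\<close> which is stable under \<open>lam\<close>, hence closed under \<open>+\<close>, hence equal to
  \<open>d\<int>\<close>; and \<open>lam\<close> is trivial modulo \<open>D\<close>.

  The second part shows that \<open>\<star>\<close> and \<open>+\<close> agree if \<open>\<star>\<close> is commutative (\<open>star_eq_plus\<close>); applied to
  \<open>D\<close>, this says that they agree there. Evaluating integer polynomials at the operator \<open>lam 1\<close> and
  the vector \<open>1\<close> identifies \<open>(\<int>, \<star>)\<close> with a quotient ring \<open>R\<close> of \<open>\<int>[t]\<close>. With \<open>u = t - 1\<close>, the
  integer \<open>n\<close> corresponds to the element \<open>f\<close> with \<open>1 + u f = t\<^sup>n\<close>; so every element of \<open>1 + u R\<close> is a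
  power of \<open>t\<close>, and it has to be shown that \<open>u = 0\<close>. As \<open>t\<^sup>2 - t + 1 = 1 + u t\<close> is a power of \<open>t\<close> and
  has leading and constant coefficient \<open>1\<close>, it yields a monic equation for \<open>t\<close>. So \<open>R\<close> is a finitely
  generated abelian group; it follows that \<open>p R \<noteq> R\<close> for every prime \<open>p\<close> (\<open>not_divisible\<close>) and that
  \<open>R\<close> is torsion-free. The group \<open>(1 + u p R) / (1 + u p\<^sup>2 R)\<close> is cyclic, and isomorphic to
  \<open>p R / p\<^sup>2 R\<close>; therefore \<open>R / p R\<close> is cyclic (\<open>quotient_cyclic\<close>), and this forces \<open>u \<in> p R\<close>
  (\<open>u_in_prime_ideal\<close>). Finally, the ideals \<open>p R\<close> correspond to proper subgroups of \<open>\<int>\<close> with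
  pairwise coprime generators, so an integer that lies in all of these subgroups is \<open>0\<close>.

  For the last part, \<open>lam 1\<close> and conjugation by \<open>1\<close> act on \<open>D\<close>, an infinite cyclic group if
  \<open>d \<noteq> 0\<close>, by signs. If conjugation is trivial, \<open>\<star>\<close> is commutative, and equal to \<open>+\<close>. If conjugation
  inverts \<open>D\<close>, comparing its effects on \<open>2\<close> and on \<open>d\<close> gives \<open>d = 2\<close> and \<open>lam 1 1 = 1 \<star> 2\<close>
  (\<open>inverting_imp_two\<close>). The sign of \<open>lam 1\<close> on \<open>D\<close> then decides: \<open>- 1\<close> yields the second
  formula and \<open>+ 1\<close> the third one.
\<close>

section \<open>Subgroups of the integers\<close>

lemma int_subgroup_principal:
  fixes A :: "int set"
  assumes zero: "0 \<in> A" and add: "\<And>a b. a \<in> A \<Longrightarrow> b \<in> A \<Longrightarrow> a + b \<in> A"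
    and minus: "\<And>a. a \<in> A \<Longrightarrow> - a \<in> A"
  obtains d where "d \<ge> 0" "A = {n. d dvd n}"
proof -
  have mult: "k * a \<in> A" if a: "a \<in> A" for k a
  proof -
    have nat: "int n * a \<in> A" for n
    proof (induction n)
      case (Suc n)
      thus ?case using add[OF a, of "int n * a"] by (simp add: algebra_simps)
    qed (simp add: zero)
    show ?thesis
    proof (cases k rule: int_cases2)
      case (nonpos n)
      thus ?thesis using minus[OF nat[of n]] by simp
    qed (simp add: nat)
  qed
  show ?thesis
  proof (cases "A = {0}")
    case True
    thus ?thesis by (intro that[of 0]) auto
  next
    case False
    then obtain a where "a \<in> A" "a \<noteq> 0" using zero by blast
    hence ex: "\<exists>n. n > 0 \<and> int n \<in> A"
      using minus[of a] by (intro exI[of _ "nat \<bar>a\<bar>"]) (simp add: abs_if)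
    define s where "s = (LEAST n. n > 0 \<and> int n \<in> A)"
    have s: "s > 0 \<and> int s \<in> A"
      using LeastI_ex[OF ex] unfolding s_def .
    have least: "s \<le> n" if "n > 0" "int n \<in> A" for n
      unfolding s_def using that by (intro Least_le) blast
    have "int s dvd n" if "n \<in> A" for n
    proof (rule ccontr)
      assume nd: "\<not> int s dvd n"
      have "n + (- (n div int s)) * int s \<in> A"
        using s by (intro add that mult) blast
      moreover have "n + (- (n div int s)) * int s = n mod int s"
        by (simp add: minus_div_mult_eq_mod)
      ultimately have m: "n mod int s \<in> A" by (simp only:)
      have "n mod int s \<noteq> 0" using nd by (simp add: mod_eq_0_iff_dvd)
      moreover have "n mod int s \<ge> 0" "n mod int s < int s" using s by simp_all
      ultimately show False using least[of "nat (n mod int s)"] m by simp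
    qed
    moreover have "n \<in> A" if "int s dvd n" for n
      using that mult s by (metis dvdE mult.commute)
    ultimately show ?thesis by (intro that[of "int s"]) auto
  qed
qed

section \<open>Rings whose circle group is infinite cyclic\<close>

text \<open>
  The ring of interest is the quotient of the type \<open>'r\<close> by the relation \<open>E f = E g\<close>, where \<open>E\<close> is to be
  thought of as a discrete logarithm: with \<open>t = 1 + u\<close>, the integer \<open>E f\<close> is the exponent \<open>n\<close> with
  \<open>1 + u * f = t\<^sup>n\<close> modulo this relation. Working with \<open>E\<close> on a ring that stays fixed avoids the
  construction of a quotient type that depends on the brace.
\<close>

locale cyclic_circle =
  fixes E :: "'r::comm_ring_1 \<Rightarrow> int" and u :: 'r
  assumes E_one: "E 1 = 1"
    and E_circle: "E (f + g + u * f * g) = E f + E g"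
    and E_cong_add: "E f = E g \<Longrightarrow> E (f + h) = E (g + h)"
    and E_cong_mult: "E f = E g \<Longrightarrow> E (f * h) = E (g * h)"
    and E_cancel: "E ((1 + u) * f) = E ((1 + u) * g) \<Longrightarrow> E f = E g"
    and powers_span: "\<exists>m (a :: nat \<Rightarrow> int). f = (\<Sum>i<m. of_int (a i) * (1 + u) ^ i)"
begin

lemma E_zero: "E 0 = 0"
  using E_circle[of 0 0] by simp

lemma E_eq_iff: "E f = E g \<longleftrightarrow> E (f - g) = 0"
  using E_cong_add[of f g "- g"] E_cong_add[of "f - g" 0 g] E_zero by auto

lemma E_eqI: "f - g = d \<Longrightarrow> E d = 0 \<Longrightarrow> E f = E g"
  by (simp add: E_eq_iff[of f g])

lemma ker_add: "E f = 0 \<Longrightarrow> E g = 0 \<Longrightarrow> E (f + g) = 0"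
  using E_cong_add[of f 0 g] E_zero by simp

lemma ker_mult: "E f = 0 \<Longrightarrow> E (h * f) = 0"
  using E_cong_mult[of f 0 h] E_zero by (simp add: mult.commute)

lemma ker_mult': "E f = 0 \<Longrightarrow> E (f * h) = 0"
  using E_cong_mult[of f 0 h] E_zero by simp

lemma ker_minus: "E f = 0 \<Longrightarrow> E (- f) = 0"
  using ker_mult[of f "-1"] by simp

lemma ker_diff: "E f = 0 \<Longrightarrow> E g = 0 \<Longrightarrow> E (f - g) = 0"
  using ker_add[of f "- g"] ker_minus by simp

lemma E_geometric: "E (\<Sum>i<k. (1 + u) ^ i) = int k"
proof (induction k)
  case 0
  show ?case by (simp add: E_zero)
next
  case (Suc k)
  have "u * (\<Sum>i<k. (1 + u) ^ i) = (1 + u) ^ k - 1"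
    using power_diff_1_eq[of "1 + u" k] by simp
  hence "(\<Sum>i<Suc k. (1 + u) ^ i)
      = 1 + (\<Sum>i<k. (1 + u) ^ i) + u * 1 * (\<Sum>i<k. (1 + u) ^ i)"
    by simp
  hence "E (\<Sum>i<Suc k. (1 + u) ^ i) = E 1 + E (\<Sum>i<k. (1 + u) ^ i)"
    by (simp only: E_circle)
  thus ?case using Suc E_one by simp
qed

text \<open>
  Multiplication by \<open>u\<close> sends the geometric sum, on which \<open>E\<close> has the value \<open>k\<close>, to \<open>(1 + u)\<^sup>k - 1\<close>. This
  makes precise the reading of \<open>E\<close> as a logarithm with base \<open>1 + u\<close>.
\<close>

lemma unit_eq_power:
  "E f = int k \<Longrightarrow> E (1 + u * f - (1 + u) ^ k) = 0"
proof -
  assume "E f = int k"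
  hence "E (f - (\<Sum>i<k. (1 + u) ^ i)) = 0"
    using E_eq_iff[of f "\<Sum>i<k. (1 + u) ^ i"] E_geometric[of k] by simp
  hence "E (u * (f - (\<Sum>i<k. (1 + u) ^ i))) = 0" by (rule ker_mult)
  moreover have "u * (f - (\<Sum>i<k. (1 + u) ^ i)) = 1 + u * f - (1 + u) ^ k"
    using power_diff_1_eq[of "1 + u" k] by (simp add: algebra_simps)
  ultimately show ?thesis by simp
qed

lemma unit_eq_inverse_power:
  "E f = - int k \<Longrightarrow> E ((1 + u * f) * (1 + u) ^ k - 1) = 0"
proof -
  assume f: "E f = - int k"
  define g where "g = (\<Sum>i<k. (1 + u) ^ i)"
  have g: "u * g = (1 + u) ^ k - 1"
    using power_diff_1_eq[of "1 + u" k] by (simp add: g_def)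
  have "E (f + g + u * f * g) = 0"
    using E_circle[of f g] f E_geometric[of k] by (simp add: g_def)
  hence "E (u * (f + g + u * f * g)) = 0" by (rule ker_mult)
  moreover have "u * (f + g + u * f * g) = (1 + u * f) * (1 + u * g) - 1"
    by (simp add: algebra_simps)
  ultimately show ?thesis by (simp add: g)
qed

definition low_degree :: "nat \<Rightarrow> 'r set" where
  "low_degree m = {f. \<exists>a :: nat \<Rightarrow> int. E (f - (\<Sum>i<m. of_int (a i) * (1 + u) ^ i)) = 0}"

lemma low_degree_power: "i < m \<Longrightarrow> (1 + u) ^ i \<in> low_degree m"
proof -
  assume "i < m"
  hence "(\<Sum>j<m. of_int (if j = i then 1 else 0) * (1 + u) ^ j) = (1 + u) ^ i"
    by (subst sum.mono_neutral_cong_right[of _ "{i}"]) auto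
  thus ?thesis unfolding low_degree_def
    by (auto intro!: exI[of _ "\<lambda>j. if j = i then 1 else 0"] simp: E_zero)
qed

lemma low_degree_add: "f \<in> low_degree m \<Longrightarrow> g \<in> low_degree m \<Longrightarrow> f + g \<in> low_degree m"
proof -
  assume "f \<in> low_degree m" "g \<in> low_degree m"
  then obtain a b :: "nat \<Rightarrow> int" where
    a: "E (f - (\<Sum>i<m. of_int (a i) * (1 + u) ^ i)) = 0" and
    b: "E (g - (\<Sum>i<m. of_int (b i) * (1 + u) ^ i)) = 0"
    unfolding low_degree_def by blast
  have "f + g - (\<Sum>i<m. of_int (a i + b i) * (1 + u) ^ i)
      = (f - (\<Sum>i<m. of_int (a i) * (1 + u) ^ i)) + (g - (\<Sum>i<m. of_int (b i) * (1 + u) ^ i))"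
    by (simp add: algebra_simps sum.distrib)
  hence "E (f + g - (\<Sum>i<m. of_int (a i + b i) * (1 + u) ^ i)) = 0"
    using ker_add[OF a b] by (simp only:)
  thus ?thesis unfolding low_degree_def mem_Collect_eq
    by (rule exI[of _ "\<lambda>i. a i + b i"])
qed

lemma low_degree_scale: "f \<in> low_degree m \<Longrightarrow> of_int c * f \<in> low_degree m"
proof -
  assume "f \<in> low_degree m"
  then obtain a :: "nat \<Rightarrow> int" where
    a: "E (f - (\<Sum>i<m. of_int (a i) * (1 + u) ^ i)) = 0"
    unfolding low_degree_def by blast
  have "of_int c * f - (\<Sum>i<m. of_int (c * a i) * (1 + u) ^ i)
      = of_int c * (f - (\<Sum>i<m. of_int (a i) * (1 + u) ^ i))"
    by (simp add: algebra_simps sum_distrib_left)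
  thus ?thesis unfolding low_degree_def using ker_mult[OF a, of "of_int c"]
    by (auto intro!: exI[of _ "\<lambda>i. c * a i"])
qed

lemma low_degree_minus: "f \<in> low_degree m \<Longrightarrow> - f \<in> low_degree m"
  using low_degree_scale[of f m "-1"] by simp

lemma low_degree_diff: "f \<in> low_degree m \<Longrightarrow> g \<in> low_degree m \<Longrightarrow> f - g \<in> low_degree m"
  using low_degree_add[of f m "- g"] low_degree_minus by simp

lemma low_degree_cong: "E (f - g) = 0 \<Longrightarrow> g \<in> low_degree m \<Longrightarrow> f \<in> low_degree m"
proof -
  assume fg: "E (f - g) = 0" and "g \<in> low_degree m"
  then obtain a :: "nat \<Rightarrow> int" where
    a: "E (g - (\<Sum>i<m. of_int (a i) * (1 + u) ^ i)) = 0"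
    unfolding low_degree_def by blast
  show ?thesis unfolding low_degree_def using ker_add[OF fg a] by auto
qed

lemma low_degree_sum: "(\<And>i. i < n \<Longrightarrow> f i \<in> low_degree m) \<Longrightarrow> (\<Sum>i<(n::nat). f i) \<in> low_degree m"
proof (induction n)
  case 0
  have "(0 :: 'r) - (\<Sum>i<m. of_int 0 * (1 + u) ^ i) = 0" by simp
  thus ?case unfolding low_degree_def using E_zero by (auto intro!: exI[of _ "\<lambda>_. 0"])
next
  case (Suc n)
  thus ?case by (simp add: low_degree_add)
qed

text \<open>
  The element \<open>1 + u * t = t\<^sup>2 - t + 1\<close> is a power \<open>t\<^sup>n\<close>. Its leading and its constant coefficient are
  both \<open>1\<close>. Whatever the sign and size of \<open>n\<close>, the equation therefore expresses a power of \<open>t\<close> through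
  smaller ones. It also exhibits an inverse of \<open>t\<close>: directly, or after \<open>t\<close> is cancelled.
\<close>

lemma inverse_and_monic_relation:
  shows "\<exists>s. E ((1 + u) * s - 1) = 0" and "\<exists>m. (1 + u) ^ m \<in> low_degree m"
proof -
  define t where "t = 1 + u"
  define n where "n = E t"
  have u: "u = t - 1" by (simp add: t_def)
  have key: "(\<exists>s. E (t * s - 1) = 0) \<and> (\<exists>m. t ^ m \<in> low_degree m)"
  proof (cases "n < 0")
    case True
    define k where "k = nat (- n) - 1"
    have nk: "E t = - int (Suc k)" using True by (simp add: n_def k_def)
    have rel: "E ((1 + u * t) * t ^ Suc k - 1) = 0"
      using unit_eq_inverse_power[OF nk] by (simp add: t_def)
    have "E (t * ((1 + u * t) * t ^ k) - 1) = 0"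
      using rel by (simp add: algebra_simps)
    moreover have "t ^ (k + 3) - (t ^ (k + 2) - t ^ (k + 1) + t ^ 0) = (1 + u * t) * t ^ Suc k - 1"
      by (simp add: u algebra_simps power_add power2_eq_square power3_eq_cube)
    moreover have "t ^ (k + 2) - t ^ (k + 1) + t ^ 0 \<in> low_degree (k + 3)"
      unfolding t_def by (intro low_degree_add low_degree_diff low_degree_power) auto
    ultimately show ?thesis using low_degree_cong rel by metis
  next
    case False
    have nk: "E t = int (nat n)" using False by (simp add: n_def)
    have rel: "E (1 + u * t - t ^ nat n) = 0"
      using unit_eq_power[OF nk] by (simp add: t_def)
    have cancel_t: "E (t - 1) = 0" if "E (t * t - t * 1) = 0"
      using E_cancel[of t 1] that by (simp only: E_eq_iff[symmetric] t_def[symmetric])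
    have triv: ?thesis if "E (t - 1) = 0"
    proof -
      have "t ^ 1 \<in> low_degree 1"
        using low_degree_cong[of "t ^ 1" "t ^ 0" 1] low_degree_power[of 0 1] that by (simp add: t_def)
      thus ?thesis using that by (metis mult.right_neutral)
    qed
    consider "nat n = 0" | "nat n = 1" | "nat n = 2" | k where "nat n = k + 3"
      by (metis One_nat_def Suc_1 add.commute add_2_eq_Suc add_Suc_right less_2_cases
          not_less_iff_gr_or_eq numeral_3_eq_3 plus_1_eq_Suc less_iff_Suc_add)
    thus ?thesis
    proof cases
      case 1
      have "E (t * t - t * 1) = 0" using rel 1 by (simp add: u algebra_simps)
      thus ?thesis using cancel_t triv by blast
    next
      case 2
      have r: "E (1 + u * t - t) = 0" using rel 2 by simp
      have "t * (2 - t) - 1 = - (1 + u * t - t)" by (simp add: u algebra_simps)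
      hence "E (t * (2 - t) - 1) = 0" using ker_minus[OF r] by (simp only:)
      moreover have "t ^ 2 - (of_int 2 * t ^ 1 - t ^ 0) = 1 + u * t - t"
        by (simp add: u algebra_simps power2_eq_square)
      moreover have "of_int 2 * t ^ 1 - t ^ 0 \<in> low_degree 2"
        unfolding t_def by (intro low_degree_diff low_degree_scale low_degree_power) auto
      ultimately show ?thesis using low_degree_cong r by metis
    next
      case 3
      have "t - 1 = - (1 + u * t - t ^ 2)" by (simp add: u algebra_simps power2_eq_square)
      thus ?thesis using triv ker_minus rel 3 by metis
    next
      case (4 k)
      have r: "E (- (1 + u * t - t ^ (k + 3))) = 0" using rel 4 ker_minus by metis
      have "t * (t ^ (k + 2) - t + 1) - 1 = - (1 + u * t - t ^ (k + 3))"
        by (simp add: u algebra_simps power_add power2_eq_square power3_eq_cube)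
      hence "E (t * (t ^ (k + 2) - t + 1) - 1) = 0" using r by (simp only:)
      moreover have "t ^ (k + 3) - (t ^ 2 - t ^ 1 + t ^ 0) = - (1 + u * t - t ^ (k + 3))"
        by (simp add: u algebra_simps power2_eq_square)
      moreover have "t ^ 2 - t ^ 1 + t ^ 0 \<in> low_degree (k + 3)"
        unfolding t_def by (intro low_degree_add low_degree_diff low_degree_power) auto
      ultimately show ?thesis using low_degree_cong r by metis
    qed
  qed
  show "\<exists>s. E ((1 + u) * s - 1) = 0" and "\<exists>m. (1 + u) ^ m \<in> low_degree m"
    using key by (auto simp: t_def)
qed

text \<open>
  The range of \<open>E\<close> is closed under addition and contains \<open>E 1 = 1\<close>. The circle inverse of \<open>1\<close>
  is \<open>- s\<close>, where \<open>s\<close> inverts \<open>1 + u\<close>, so \<open>- 1\<close> is a value as well.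
\<close>

lemma E_surj: "\<exists>f. E f = n"
proof -
  obtain s where s: "E ((1 + u) * s - 1) = 0"
    using inverse_and_monic_relation by blast
  have "1 + - s + u * 1 * (- s) = - ((1 + u) * s - 1)" by (simp add: algebra_simps)
  hence "E 1 + E (- s) = 0"
    using E_circle[of 1 "- s"] ker_minus[OF s] by (simp only:)
  hence m1: "E (- s) = - 1" using E_one by simp
  have "\<exists>f. E f = int k" for k using E_geometric by blast
  moreover have "\<exists>f. E f = - int k" for k
  proof (induction k)
    case 0
    show ?case using E_zero by auto
  next
    case (Suc k)
    then obtain f where f: "E f = - int k" by blast
    have "E (f + - s + u * f * (- s)) = - int (Suc k)"
      using E_circle[of f "- s"] f m1 by simp
    thus ?case by blast
  qed
  ultimately show ?thesis by (cases n rule: int_cases2) auto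
qed

lemma finitely_spanned: "\<exists>m. \<forall>f. f \<in> low_degree m"
proof -
  obtain m where m: "(1 + u) ^ m \<in> low_degree m"
    using inverse_and_monic_relation by blast
  have step: "(1 + u) * f \<in> low_degree m" if "f \<in> low_degree m" for f
  proof -
    obtain a :: "nat \<Rightarrow> int" where
      a: "E (f - (\<Sum>i<m. of_int (a i) * (1 + u) ^ i)) = 0"
      using \<open>f \<in> low_degree m\<close> unfolding low_degree_def by blast
    have "(1 + u) * f - (\<Sum>i<m. of_int (a i) * (1 + u) ^ Suc i)
        = (1 + u) * (f - (\<Sum>i<m. of_int (a i) * (1 + u) ^ i))"
      by (simp only: right_diff_distrib sum_distrib_left power_Suc mult.left_commute)
    hence "E ((1 + u) * f - (\<Sum>i<m. of_int (a i) * (1 + u) ^ Suc i)) = 0"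
      using ker_mult[OF a] by simp
    moreover have "(1 + u) ^ Suc i \<in> low_degree m" if "i < m" for i
      using that m low_degree_power[of "Suc i" m] by (cases "Suc i = m") auto
    hence "(\<Sum>i<m. of_int (a i) * (1 + u) ^ Suc i) \<in> low_degree m"
      by (intro low_degree_sum low_degree_scale)
    ultimately show ?thesis using low_degree_cong by blast
  qed
  have "(1 + u) ^ i \<in> low_degree m" for i
  proof (induction i)
    case 0
    show ?case using m low_degree_power[of 0 m] by (cases m) auto
  next
    case (Suc i)
    thus ?case using step by simp
  qed
  hence "f \<in> low_degree m" for f
    using powers_span[of f] by (auto intro!: low_degree_sum low_degree_scale)
  thus ?thesis by blast
qed

text \<open>
  A nonzero integer \<open>c\<close> in the kernel would allow the finitely many coefficients to be reduced
  modulo \<open>c\<close>, and \<open>E\<close> would take only finitely many values.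
\<close>

lemma integer_not_killed:
  assumes "c \<noteq> 0"
  shows "E (of_int c) \<noteq> 0"
proof
  assume c: "E (of_int c) = 0"
  obtain m where m: "\<And>f. f \<in> low_degree m" using finitely_spanned by blast
  define T where "T = {xs. set xs \<subseteq> {0..<\<bar>c\<bar>} \<and> length xs = m}"
  define G where "G xs = E (\<Sum>i<m. of_int (xs ! i) * (1 + u) ^ i)" for xs :: "int list"
  have "n \<in> G ` T" for n
  proof -
    obtain f where f: "E f = n" using E_surj by blast
    obtain a :: "nat \<Rightarrow> int" where a: "E (f - (\<Sum>i<m. of_int (a i) * (1 + u) ^ i)) = 0"
      using m[of f] unfolding low_degree_def by blast
    define xs where "xs = map (\<lambda>i. a i mod \<bar>c\<bar>) [0..<m]"
    have "xs \<in> T" using assms by (auto simp: T_def xs_def)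
    have eq: "\<exists>k. a i = xs ! i + c * k" if "i < m" for i
    proof -
      have "a i = a i mod \<bar>c\<bar> + \<bar>c\<bar> * (a i div \<bar>c\<bar>)" by simp
      hence "a i = a i mod \<bar>c\<bar> + c * (sgn c * (a i div \<bar>c\<bar>))"
        by (metis abs_sgn mult.assoc)
      thus ?thesis using that by (auto simp: xs_def)
    qed
    then obtain b where b: "\<And>i. i < m \<Longrightarrow> a i = xs ! i + c * b i" by metis
    have "(\<Sum>i<m. of_int (a i) * (1 + u) ^ i)
      = (\<Sum>i<m. of_int (xs ! i) * (1 + u) ^ i + of_int c * (of_int (b i) * (1 + u) ^ i))"
      by (rule sum.cong) (simp_all add: b algebra_simps)
    hence "f - (\<Sum>i<m. of_int (xs ! i) * (1 + u) ^ i) =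
      (f - (\<Sum>i<m. of_int (a i) * (1 + u) ^ i)) + of_int c * (\<Sum>i<m. of_int (b i) * (1 + u) ^ i)"
      by (simp add: sum.distrib sum_distrib_left algebra_simps)
    hence "E (f - (\<Sum>i<m. of_int (xs ! i) * (1 + u) ^ i)) = 0"
      using ker_add[OF a ker_mult'[OF c]] by (simp only:)
    hence "G xs = n" unfolding G_def f[symmetric] by (simp only: E_eq_iff[symmetric])
    thus ?thesis using \<open>xs \<in> T\<close> by blast
  qed
  hence "G ` T = UNIV" by blast
  moreover have "finite T" unfolding T_def by (rule finite_lists_length_eq) simp
  ultimately show False using infinite_UNIV_int by (metis finite_imageI)
qed

text \<open>
  This is the determinant trick (the Cayley-Hamilton form of Nakayama's lemma) for the ideal
  generated by \<open>p\<close> in \<open>\<int>\<close>. It is done by Gaussian elimination: the equation for \<open>x m\<close> has the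
  coefficient \<open>1 - p * b m\<close> at \<open>x m\<close>, and multiplying by it keeps all factors congruent to \<open>1\<close> modulo \<open>p\<close>.
\<close>

lemma elimination:
  fixes x :: "nat \<Rightarrow> 'r" and p :: int
  assumes "\<And>i. i < m \<Longrightarrow> \<exists>a :: nat \<Rightarrow> int. E (x i - of_int p * (\<Sum>j<m. of_int (a j) * x j)) = 0"
  shows "\<exists>k. \<forall>i<m. E (of_int (1 + p * k) * x i) = 0"
  using assms
proof (induction m)
  case 0
  show ?case by simp
next
  case (Suc m)
  obtain b :: "nat \<Rightarrow> int" where
    b: "E (x m - of_int p * ((\<Sum>j<m. of_int (b j) * x j) + of_int (b m) * x m)) = 0"
    using Suc.prems[of m] by auto
  define B where "B = x m - of_int p * ((\<Sum>j<m. of_int (b j) * x j) + of_int (b m) * x m)"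
  have "\<exists>a :: nat \<Rightarrow> int. E (x i - of_int p * (\<Sum>j<m. of_int (a j) * x j)) = 0" if "i < m" for i
  proof -
    obtain a :: "nat \<Rightarrow> int" where
      a: "E (x i - of_int p * ((\<Sum>j<m. of_int (a j) * x j) + of_int (a m) * x m)) = 0"
      using Suc.prems[of i] \<open>i < m\<close> by auto
    define A where "A = x i - of_int p * ((\<Sum>j<m. of_int (a j) * x j) + of_int (a m) * x m)"
    \<comment> \<open>The last summand restores \<open>x i\<close> after multiplication by \<open>1 - p * b m\<close>.\<close>
    define e where "e j = (1 - p * b m) * a j + p * a m * b j + (if j = i then b m else 0)" for j
    have si: "(\<Sum>j<m. of_int (if j = i then b m else 0) * x j) = of_int (b m) * x i"
      using \<open>i < m\<close> by (subst sum.mono_neutral_cong_right[of _ "{i}"]) auto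
    have "(\<Sum>j<m. of_int (e j) * x j) =
        of_int (1 - p * b m) * (\<Sum>j<m. of_int (a j) * x j)
        + of_int (p * a m) * (\<Sum>j<m. of_int (b j) * x j) + of_int (b m) * x i"
      unfolding si[symmetric]
      by (simp add: e_def sum_distrib_left sum.distrib algebra_simps sum_subtractf)
    hence "x i - of_int p * (\<Sum>j<m. of_int (e j) * x j)
        = of_int (1 - p * b m) * A + of_int (p * a m) * B"
      unfolding A_def B_def by (simp only:) (simp add: algebra_simps)
    moreover have "E (of_int (1 - p * b m) * A + of_int (p * a m) * B) = 0"
      using a b by (intro ker_add ker_mult) (simp_all add: A_def B_def)
    ultimately show ?thesis by metis
  qed
  then obtain k where k: "\<And>i. i < m \<Longrightarrow> E (of_int (1 + p * k) * x i) = 0"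
    using Suc.IH by blast
  define k' where "k' = k - b m - p * k * b m"
  have k': "1 + p * k' = (1 - p * b m) * (1 + p * k)"
    by (simp add: k'_def algebra_simps)
  have "E (of_int (1 + p * k') * x i) = 0" if "i < Suc m" for i
  proof (cases "i < m")
    case True
    show ?thesis unfolding k' of_int_mult mult.assoc
      by (rule ker_mult) (use k[OF True] in simp)
  next
    case False
    hence i: "i = m" using that by simp
    have s: "E (\<Sum>j<n. of_int (b j) * (of_int (1 + p * k) * x j)) = 0" if "n \<le> m" for n
      using that by (induction n) (auto simp del: of_int_add intro!: ker_add ker_mult k simp: E_zero)
    have "of_int (1 + p * k') * x i =
        of_int (1 + p * k) * B + of_int p * (\<Sum>j<m. of_int (b j) * (of_int (1 + p * k) * x j))"
      unfolding k' i B_def by (simp add: algebra_simps sum_distrib_left sum.distrib)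
    moreover have "E B = 0" using b by (simp add: B_def)
    ultimately show ?thesis using s[of m] ker_add ker_mult by simp
  qed
  thus ?case by blast
qed


text \<open>
  If \<open>p\<close> were invertible, every power of \<open>1 + u\<close> would be \<open>p\<close> times a combination of finitely many,
  and elimination would produce a nonzero integer \<open>1 + p * k\<close> in the kernel.
\<close>

lemma not_divisible:
  assumes "\<bar>p\<bar> \<noteq> 1"
  shows "E (of_int p * h - 1) \<noteq> 0"
proof
  assume h: "E (of_int p * h - 1) = 0"
  obtain m where m: "\<And>f. f \<in> low_degree m" using finitely_spanned by blast
  have "\<exists>a :: nat \<Rightarrow> int. E ((1 + u) ^ i - of_int p * (\<Sum>j<m. of_int (a j) * (1 + u) ^ j)) = 0" for i
  proof -
    obtain a :: "nat \<Rightarrow> int" where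
      a: "E (h * (1 + u) ^ i - (\<Sum>j<m. of_int (a j) * (1 + u) ^ j)) = 0"
      using m unfolding low_degree_def by blast
    have "(1 + u) ^ i - of_int p * (\<Sum>j<m. of_int (a j) * (1 + u) ^ j)
      = of_int p * (h * (1 + u) ^ i - (\<Sum>j<m. of_int (a j) * (1 + u) ^ j))
        - (of_int p * h - 1) * (1 + u) ^ i"
      by (simp add: algebra_simps)
    hence "E ((1 + u) ^ i - of_int p * (\<Sum>j<m. of_int (a j) * (1 + u) ^ j)) = 0"
      using ker_diff[OF ker_mult[OF a] ker_mult'[OF h]] by (simp only:)
    thus ?thesis by blast
  qed
  then obtain k where k: "\<And>i. i < m \<Longrightarrow> E (of_int (1 + p * k) * (1 + u) ^ i) = 0"
    using elimination[of m "\<lambda>i. (1 + u) ^ i" p] by blast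
  have "m \<noteq> 0"
  proof
    assume "m = 0"
    hence "E 1 = 0" using m[of 1] unfolding low_degree_def by simp
    thus False using E_one by simp
  qed
  hence "E (of_int (1 + p * k)) = 0" using k[of 0] by simp
  moreover have "1 + p * k \<noteq> 0"
  proof
    assume "1 + p * k = 0"
    hence "p * (- k) = 1" by simp
    thus False using assms by (metis abs_zmult_eq_1 abs_1)
  qed
  ultimately show False using integer_not_killed by blast
qed

text \<open>
  Ideals are closed under the circle operation, so these sets of exponents are subgroups of \<open>\<int>\<close>, and
  the principal ideals of integers can be compared through the generators of these subgroups.
\<close>

definition ideal_image :: "int \<Rightarrow> int set" where
  "ideal_image p = range (\<lambda>f. E (of_int p * f))"

lemma ideal_imageE:
  assumes "a \<in> ideal_image p"
  obtains f where "a = E (of_int p * f)"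
  using assms unfolding ideal_image_def by (rule rangeE)

lemma ideal_image_add:
  assumes "a \<in> ideal_image p" "b \<in> ideal_image p"
  shows "a + b \<in> ideal_image p"
proof -
  obtain f g where "a = E (of_int p * f)" "b = E (of_int p * g)"
    using assms by (elim ideal_imageE)
  moreover have "of_int p * f + of_int p * g + u * (of_int p * f) * (of_int p * g)
      = of_int p * (f + g + u * f * (of_int p * g))"
    by (simp add: algebra_simps)
  ultimately show ?thesis
    unfolding ideal_image_def using E_circle by (metis rangeI)
qed

lemma ideal_imageD:
  assumes "E g \<in> ideal_image p"
  shows "\<exists>h. E (g - of_int p * h) = 0"
  using assms E_eq_iff unfolding ideal_image_def by blast

lemma circle_inverse: "\<exists>g. E g = - E f \<and> E (f + g + u * f * g) = 0"
proof -
  obtain g where "E g = - E f" using E_surj by blast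
  thus ?thesis using E_circle[of f g] by auto
qed

text \<open>
  The additive coset of \<open>f\<close> modulo the ideal of \<open>p\<close> is also its circle coset: with \<open>g\<close> the circle
  inverse of \<open>f\<close>, the circle product of \<open>f + p * h\<close> and \<open>g\<close> is a multiple of \<open>p\<close>.
\<close>

lemma ideal_image_diff_mem: "E (f + of_int p * h) - E f \<in> ideal_image p"
proof -
  obtain g where g: "E g = - E f" "E (f + g + u * f * g) = 0"
    using circle_inverse by blast
  have "f + of_int p * h + g + u * (f + of_int p * h) * g - of_int p * (h + u * h * g)
     = f + g + u * f * g"
    by (simp add: algebra_simps)
  hence "E (f + of_int p * h + g + u * (f + of_int p * h) * g) = E (of_int p * (h + u * h * g))"
    using g(2) by (rule E_eqI)
  hence "E (f + of_int p * h) - E f = E (of_int p * (h + u * h * g))"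
    using E_circle[of "f + of_int p * h" g] g(1) by simp
  thus ?thesis unfolding ideal_image_def by (metis rangeI)
qed

lemma ideal_image_uminus:
  assumes "a \<in> ideal_image p"
  shows "- a \<in> ideal_image p"
proof -
  obtain f where "a = E (of_int p * f)" using assms by (rule ideal_imageE)
  thus ?thesis
    using ideal_image_diff_mem[of "of_int p * f" p "- f"] E_zero by simp
qed

lemma ideal_image_zero: "0 \<in> ideal_image p"
proof -
  have "E (of_int p * 0) \<in> ideal_image p" unfolding ideal_image_def by blast
  thus ?thesis by (simp add: E_zero)
qed

lemma ideal_image_multiples: "\<exists>s. ideal_image p = {n. s dvd n}"
proof -
  obtain s where "ideal_image p = {n. s dvd n}"
    by (rule int_subgroup_principal[of "ideal_image p"])
      (blast intro: ideal_image_zero ideal_image_add ideal_image_uminus)+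
  thus ?thesis by (rule exI)
qed

lemma ideal_image_mult: "a \<in> ideal_image p \<Longrightarrow> k * a \<in> ideal_image p"
proof -
  assume "a \<in> ideal_image p"
  moreover obtain s where "ideal_image p = {n. s dvd n}" using ideal_image_multiples by (rule exE)
  ultimately show ?thesis by simp
qed

text \<open>
  The annihilator of \<open>p\<close> is an ideal. If it is nonzero it has finite index, as all nonzero subgroups of
  \<open>\<int>\<close> have. Then \<open>ideal_image p\<close> is finite; but it contains all multiples of the nonzero integer
  \<open>E (of_int p)\<close>.
\<close>

lemma torsion_free:
  assumes p: "p \<noteq> 0" and f: "E (of_int p * f) = 0"
  shows "E f = 0"
proof (rule ccontr)
  define k where "k = \<bar>E f\<bar>"
  assume "E f \<noteq> 0"
  hence k: "k > 0" by (simp add: k_def)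
  have shift: "E (of_int p * g') = E (of_int p * g)" if g: "E g' = E g + c * E f" for g g' c
  proof -
    \<comment> \<open>The exponents of the annihilator of \<open>p\<close>.\<close>
    define A where "A = {n. \<exists>a. E a = n \<and> E (of_int p * a) = 0}"
    have add: "x + y \<in> A" if "x \<in> A" "y \<in> A" for x y
    proof -
      from that obtain a b where
        ab: "E a = x" "E b = y" "E (of_int p * a) = 0" "E (of_int p * b) = 0"
        unfolding A_def by blast
      have "of_int p * (a + b + u * a * b) = of_int p * a + of_int p * b + (of_int p * a) * (u * b)"
        by (simp add: algebra_simps)
      hence "E (of_int p * (a + b + u * a * b)) = 0"
        using ker_add[OF ker_add[OF ab(3,4)] ker_mult'[OF ab(3)]] by (simp only:)
      moreover have "E (a + b + u * a * b) = x + y" using E_circle[of a b] ab by simp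
      ultimately show ?thesis unfolding A_def by blast
    qed
    have neg: "- x \<in> A" if "x \<in> A" for x
    proof -
      from that obtain a where a: "E a = x" "E (of_int p * a) = 0"
        unfolding A_def by blast
      obtain b where b: "E b = - E a" "E (a + b + u * a * b) = 0"
        using circle_inverse by blast
      have "of_int p * b = of_int p * (a + b + u * a * b) - (of_int p * a) * (1 + u * b)"
        by (simp add: algebra_simps)
      hence "E (of_int p * b) = 0"
        using ker_diff[OF ker_mult[OF b(2)] ker_mult'[OF a(2)]] by (simp only:)
      moreover have "E b = - x" using a b by simp
      ultimately show ?thesis unfolding A_def by blast
    qed
    have "0 \<in> A" unfolding A_def using E_zero by (auto intro!: exI[of _ 0])
    then obtain d where d: "A = {n. d dvd n}"
      using add neg by (rule int_subgroup_principal[of A])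
    have "E f \<in> A" unfolding A_def using f by blast
    hence "c * E f \<in> A" by (simp add: d)
    then obtain a where a: "E a = c * E f" "E (of_int p * a) = 0"
      unfolding A_def by blast
    have "E (g' - (g + a + u * g * a)) = 0"
      using E_circle[of g a] a g by (simp only: E_eq_iff[symmetric])
    hence ker: "E (of_int p * (g' - (g + a + u * g * a)) + (1 + u * g) * (of_int p * a)) = 0"
      using ker_add[OF ker_mult ker_mult[OF a(2)]] by blast
    have "of_int p * g' - of_int p * g =
        of_int p * (g' - (g + a + u * g * a)) + (1 + u * g) * (of_int p * a)"
      by (simp add: algebra_simps)
    thus ?thesis using ker by (rule E_eqI)
  qed
  define r where "r n = (SOME f. E f = n)" for n
  have r: "E (r n) = n" for n
    unfolding r_def using E_surj by (rule someI_ex)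
  have "ideal_image p \<subseteq> (\<lambda>n. E (of_int p * r n)) ` {0..<k}"
  proof
    fix x assume "x \<in> ideal_image p"
    then obtain g where g: "x = E (of_int p * g)" by (rule ideal_imageE)
    have "k = E f * sgn (E f)" unfolding k_def by (rule abs_sgn)
    hence "k * (E g div k) = (sgn (E f) * (E g div k)) * E f"
      by (simp only: mult.commute mult.left_commute)
    hence "E g = E g mod k + (sgn (E f) * (E g div k)) * E f"
      using mod_mult_div_eq[of "E g" k] by (simp only:)
    hence "E g = E (r (E g mod k)) + (sgn (E f) * (E g div k)) * E f"
      by (simp only: r)
    hence "x = E (of_int p * r (E g mod k))" using shift g by blast
    thus "x \<in> (\<lambda>n. E (of_int p * r n)) ` {0..<k}" using k by simp
  qed
  hence fin: "finite (ideal_image p)" by (rule finite_subset) simp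
  have "E (of_int p) \<in> ideal_image p"
    unfolding ideal_image_def by (metis mult.right_neutral rangeI)
  hence "(\<lambda>c. c * E (of_int p)) ` UNIV \<subseteq> ideal_image p"
    using ideal_image_mult by blast
  moreover have "inj (\<lambda>c. c * E (of_int p))"
    using integer_not_killed[OF p] by (simp add: inj_on_def)
  ultimately show False
    using finite_imageD[OF finite_subset[OF _ fin]] infinite_UNIV_int by blast
qed

text \<open>
  On the ideal of \<open>p\<close>, the circle operation is addition modulo \<open>p\<^sup>2\<close>. If \<open>E (p * w)\<close> generates
  \<open>ideal_image p\<close>, any multiple \<open>p * g\<close> is a circle power of \<open>p * w\<close>, thus an integer multiple of
  \<open>p * w\<close> modulo \<open>p\<^sup>2\<close>. Torsion-freeness permits division by \<open>p\<close>.
\<close>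

lemma quotient_cyclic:
  assumes p: "p \<noteq> 0"
  shows "\<exists>w. \<forall>g. \<exists>n :: int. \<exists>h. E (g - (of_int n * w + of_int p * h)) = 0"
proof -
  obtain s where "ideal_image p = {n. s dvd n}" using ideal_image_multiples by (rule exE)
  hence s: "s \<in> ideal_image p" "\<And>n. n \<in> ideal_image p \<Longrightarrow> s dvd n" by simp_all
  obtain w where w: "s = E (of_int p * w)" by (rule ideal_imageE[OF s(1)])
  define P where "P = (of_int p :: 'r)"
  define T where "T = {n :: int. \<exists>h. E (P * (of_int n * w + P * h)) = n * s}"
  have add: "m + n \<in> T" if "m \<in> T" "n \<in> T" for m n
  proof -
    from that obtain h h' where h: "E (P * (of_int m * w + P * h)) = m * s"
        "E (P * (of_int n * w + P * h')) = n * s"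
      unfolding T_def by blast
    define f where "f = of_int m * w + P * h"
    define g where "g = of_int n * w + P * h'"
    have "P * (of_int (m + n) * w + P * (h + h' + u * f * g)) = P * f + P * g + u * (P * f) * (P * g)"
      unfolding f_def g_def by (simp add: algebra_simps)
    hence "E (P * (of_int (m + n) * w + P * (h + h' + u * f * g))) = (m + n) * s"
      using h E_circle[of "P * f" "P * g"] by (simp only: f_def g_def distrib_right)
    thus ?thesis unfolding T_def by blast
  qed
  have "E (P * (of_int 1 * w + P * 0)) = 1 * s" using w by (simp add: P_def)
  hence one: "1 \<in> T" unfolding T_def by blast
  have minus_one: "- 1 \<in> T"
  proof -
    have "- s \<in> ideal_image p" by (rule ideal_image_uminus[OF s(1)])
    then obtain g where g: "- s = E (P * g)" unfolding P_def by (rule ideal_imageE)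
    have ker: "E (P * g + P * w + u * (P * g) * (P * w)) = 0"
      using E_circle[of "P * g" "P * w"] g w by (simp add: P_def)
    have "P * g - P * (of_int (- 1) * w + P * (- (u * g * w)))
       = P * g + P * w + u * (P * g) * (P * w)"
      by (simp add: algebra_simps)
    hence "E (P * g) = E (P * (of_int (- 1) * w + P * (- (u * g * w))))"
      using ker by (rule E_eqI)
    hence "E (P * (of_int (- 1) * w + P * (- (u * g * w)))) = - 1 * s"
      using g by simp
    thus ?thesis unfolding T_def by blast
  qed
  have T: "n \<in> T" for n
  proof (induction n rule: int_induct[of _ 1])
    case base
    show ?case by (rule one)
  next
    case (step1 i)
    show ?case by (rule add[OF step1(2) one])
  next
    case (step2 i)
    show ?case using add[OF step2(2) minus_one] by simp
  qed
  have "\<exists>n :: int. \<exists>h. E (g - (of_int n * w + of_int p * h)) = 0" for g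
  proof -
    have "s dvd E (P * g)" by (rule s(2)) (simp add: ideal_image_def P_def)
    then obtain n where n: "E (P * g) = n * s" by (metis dvd_def mult.commute)
    from T[of n] obtain h where "E (P * (of_int n * w + P * h)) = n * s"
      unfolding T_def by blast
    hence "E (P * (g - (of_int n * w + P * h))) = 0"
      using n by (simp only: right_diff_distrib E_eq_iff[symmetric])
    hence "E (g - (of_int n * w + P * h)) = 0"
      unfolding P_def by (rule torsion_free[OF p])
    thus ?thesis unfolding P_def by (intro exI)
  qed
  thus ?thesis by blast
qed

text \<open>
  Modulo \<open>p\<close> the ring is spanned by \<open>w\<close>, and \<open>u * w * w\<close> is \<open>c * w\<close> for an integer \<open>c\<close>. If \<open>p\<close>
  did not divide \<open>c\<close>, a multiple \<open>e\<close> of \<open>w\<close> would satisfy \<open>u * e * e = - e\<close> modulo \<open>p\<close>, so \<open>e\<close> would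
  be idempotent for the circle operation, a group operation. Then \<open>e\<close>, \<open>w\<close> and \<open>1\<close> would be divisible
  by \<open>p\<close>. Hence \<open>p\<close> divides \<open>c\<close>, and \<open>u = u * 1 * 1\<close> vanishes modulo \<open>p\<close> because \<open>1\<close> is a multiple of \<open>w\<close>.
\<close>

lemma u_in_prime_ideal:
  assumes p: "prime (p :: int)"
  shows "E u \<in> ideal_image p"
proof -
  define P where "P = (of_int p :: 'r)"
  have p0: "p \<noteq> 0" and p1: "\<bar>p\<bar> \<noteq> 1" using p by auto
  from quotient_cyclic[OF p0]
  obtain w where w: "\<forall>g. \<exists>n :: int. \<exists>h. E (g - (of_int n * w + P * h)) = 0"
    unfolding P_def by (rule exE)
  obtain a :: int and h1 where a: "E (1 - (of_int a * w + P * h1)) = 0" using w by blast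
  obtain c :: int and h2 where c: "E (u * w * w - (of_int c * w + P * h2)) = 0" using w by blast
  have "p dvd c"
  proof (rule ccontr)
    assume "\<not> p dvd c"
    hence "coprime c p" using p by (metis coprime_commute prime_imp_coprime)
    then obtain x y where xy: "x * c + y * p = 1"
      using bezout_int[of c p] by (metis coprime_imp_gcd_eq_1)
    have xy': "of_int x * of_int c + of_int y * P = (1 :: 'r)"
      using arg_cong[OF xy, of "of_int :: int \<Rightarrow> 'r"] by (simp add: P_def)
    \<comment> \<open>As \<open>x * c\<close> is \<open>1\<close> modulo \<open>p\<close>, this choice makes \<open>u * e * e\<close> equal to \<open>- e\<close> modulo \<open>p\<close>.\<close>
    define e where "e = - of_int x * w"
    define h where "h = - of_int x * of_int y * w + of_int x * of_int x * h2"
    have "e + e + u * e * e - (e + P * h) =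
       of_int x * of_int x * (u * w * w - (of_int c * w + P * h2))
       + (of_int x * of_int c + of_int y * P - 1) * (of_int x * w)"
      unfolding e_def h_def by (simp add: algebra_simps)
    hence "E (e + e + u * e * e - (e + P * h)) = 0"
      using ker_mult[OF c] xy' by simp
    hence "E e + E e = E (e + P * h)"
      by (simp only: E_eq_iff[symmetric] E_circle)
    hence "E e \<in> ideal_image p"
      using ideal_image_diff_mem[of e p h] unfolding P_def \<open>E e + E e = _\<close>[unfolded P_def, symmetric]
      by simp
    then obtain h3 where h3: "E (e - P * h3) = 0"
      using ideal_imageD unfolding P_def by blast
    define H where "H = of_int a * (of_int y * w - of_int c * h3) + h1"
    have "P * H - 1 = of_int a * of_int c * (e - P * h3) - (1 - (of_int a * w + P * h1))
        + (of_int x * of_int c + of_int y * P - 1) * (of_int a * w)"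
      unfolding e_def H_def by (simp add: algebra_simps)
    also have "\<dots> = of_int a * of_int c * (e - P * h3) - (1 - (of_int a * w + P * h1))"
      by (simp add: xy')
    finally have "E (P * H - 1) = 0"
      using ker_diff[OF ker_mult[OF h3] a] by (simp only:)
    thus False using not_divisible[OF p1] unfolding P_def by blast
  qed
  then obtain d where d: "(of_int c :: 'r) = P * of_int d"
    unfolding P_def by (metis dvd_def of_int_mult)
  define v where "v = of_int a * w + P * h1"
  define H where "H = of_int a * of_int a * (of_int d * w + h2)
      + u * h1 * (of_int a * w + v)"
  have "u - P * H = u * (1 + v) * (1 - v)
      + of_int a * of_int a * (u * w * w - (of_int c * w + P * h2))"
    unfolding H_def d v_def by (simp add: algebra_simps)
  moreover have "E (u * (1 + v) * (1 - v)) = 0"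
    using ker_mult[OF a] unfolding v_def .
  ultimately have "E (u - P * H) = 0"
    using ker_add[OF _ ker_mult[OF c]] by (simp only:)
  hence "E u = E (of_int p * H)" by (simp only: E_eq_iff[symmetric] P_def)
  thus ?thesis unfolding ideal_image_def by (rule range_eqI)
qed

text \<open>
  The generators of the subgroups \<open>ideal_image p\<close>, for \<open>p\<close> prime, are pairwise coprime because
  \<open>a * p + b * q = 1\<close> splits the exponent \<open>1 = E 1\<close>. They are not units as \<open>p\<close> is not invertible.
  A nonzero \<open>E u\<close> would have all of these infinitely many integers as divisors.
\<close>

theorem E_u_eq_zero: "E u = 0"
proof (rule ccontr)
  assume nz: "E u \<noteq> 0"
  define s where "s p = (SOME s. ideal_image p = {n. s dvd n})" for p
  have "ideal_image p = {n. s p dvd n}" for p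
    unfolding s_def using ideal_image_multiples by (rule someI_ex)
  hence s: "s p \<in> ideal_image p" "\<And>n. n \<in> ideal_image p \<Longrightarrow> s p dvd n" for p
    by simp_all
  have coprime: "coprime (s p) (s q)" if "coprime p q" for p q
  proof -
    from bezout_int[of p q] obtain a b where "a * p + b * q = gcd p q" by blast
    hence ab: "a * p + b * q = 1" using that by simp
    have "E (of_int p * of_int a) \<in> ideal_image p"
      unfolding ideal_image_def by (rule rangeI)
    moreover have "1 - E (of_int p * of_int a) \<in> ideal_image q"
    proof -
      have eq: "of_int p * of_int a + of_int q * of_int b = (1 :: 'r)"
        using arg_cong[OF ab, of "of_int :: int \<Rightarrow> 'r"] by (simp add: mult.commute)
      show ?thesis
        using ideal_image_diff_mem[of "of_int p * of_int a" q "of_int b"] by (simp only: eq E_one)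
    qed
    ultimately have dvd: "s p dvd E (of_int p * of_int a)" "s q dvd 1 - E (of_int p * of_int a)"
      by (simp_all only: s(2))
    show ?thesis
    proof (rule coprimeI)
      fix d assume "d dvd s p" "d dvd s q"
      hence "d dvd E (of_int p * of_int a) + (1 - E (of_int p * of_int a))"
        using dvd by (intro dvd_add) (rule dvd_trans; assumption)+
      thus "is_unit d" by simp
    qed
  qed
  have "\<not> is_unit (s p)" if "prime p" for p
  proof
    assume "is_unit (s p)"
    then obtain k where "1 = s p * k" by (rule dvdE)
    hence "E 1 \<in> ideal_image p"
      using ideal_image_mult[OF s(1)[of p], of k] E_one by (simp add: mult.commute)
    then obtain h where "E (1 - of_int p * h) = 0" using ideal_imageD by blast
    hence "E (of_int p * h - 1) = 0" using ker_minus[of "1 - of_int p * h"] by simp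
    moreover have "\<bar>p\<bar> \<noteq> 1" using that by auto
    ultimately show False using not_divisible by blast
  qed
  moreover have "p = q" if "prime p" "prime q" "s p = s q" "\<not> is_unit (s p)" for p q
  proof (rule ccontr)
    assume "p \<noteq> q"
    hence "coprime p q" using that(1,2) by (intro primes_coprime)
    thus False using coprime[of p q] that(3,4) by simp
  qed
  ultimately have "inj_on s {p. prime p}" by (intro inj_onI) blast
  moreover have "s ` {p. prime p} \<subseteq> {d. d dvd E u}"
    using s(2)[OF u_in_prime_ideal] by blast
  moreover have "finite {d. d dvd E u}" using nz by (rule finite_divisors_int)
  ultimately have fin: "finite {p :: int. prime p}"
    by (rule finite_imageD[OF finite_subset, rotated -1])
  have "int ` {p. prime p} \<subseteq> {p. prime p}" by auto
  hence "finite (int ` {p. prime p})"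
    using fin by (rule finite_subset)
  hence "finite {p :: nat. prime p}"
    by (rule finite_imageD) simp
  thus False using primes_infinite by blast
qed

end

section \<open>Braces with an abelian additive group\<close>

text \<open>
  A skew brace whose multiplicative group is \<open>(\<int>, +)\<close>; the additive group is \<open>(\<int>, \<star>)\<close>, with inverse
  \<open>iv\<close>. Both groups have the neutral element \<open>0\<close>.
\<close>

locale int_brace = Groups.group star 0 iv
  for star :: "int \<Rightarrow> int \<Rightarrow> int" (infixl "\<star>" 70) and iv :: "int \<Rightarrow> int" +
  assumes brace: "i + (j \<star> k) = (i + j) \<star> iv i \<star> (i + k)"
begin

definition lam :: "int \<Rightarrow> int \<Rightarrow> int" where
  "lam i j = iv i \<star> (i + j)"

lemma inv_cancel: "iv i \<star> (i \<star> j) = j" "i \<star> (iv i \<star> j) = j"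
  by (simp_all add: assoc[symmetric])

lemma plus_eq: "i + j = i \<star> lam i j"
  by (simp add: lam_def inv_cancel)

lemma lam_star: "lam i (j \<star> k) = lam i j \<star> lam i k"
  by (simp add: lam_def brace assoc)

lemma lam_zero_left [simp]: "lam 0 j = j"
  using plus_eq[of 0 j] by simp

lemma lam_add: "lam (i + j) k = lam i (lam j k)"
proof -
  have "(i + j) \<star> lam (i + j) k = i + (j + k)" by (simp add: plus_eq[symmetric])
  also have "\<dots> = i + (j \<star> lam j k)" by (simp only: plus_eq[symmetric])
  also have "\<dots> = (i + j) \<star> lam i (lam j k)" by (simp add: brace lam_def assoc)
  finally show ?thesis by (metis inv_cancel(1))
qed

lemma lam_cancel [simp]: "lam (- i) (lam i k) = k" "lam i (lam (- i) k) = k"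
  by (simp_all flip: lam_add)

lemma lam_comm: "lam i (lam j k) = lam j (lam i k)"
  by (metis lam_add add.commute)

lemma lam_inj: "lam i j = lam i k \<longleftrightarrow> j = k"
  by (metis lam_cancel(1))

lemma lam_zero [simp]: "lam i 0 = 0"
  by (simp add: lam_def)

lemma lam_inv: "lam i (iv j) = iv (lam i j)"
  by (metis lam_star lam_zero inverse_unique right_inverse)

lemma star_eq: "i \<star> j = i + lam (- i) j"
  by (simp add: plus_eq)

lemma star_left_cancel: "i \<star> j = i \<star> k \<longleftrightarrow> j = k"
  by (metis inv_cancel(1))

lemma star_right_cancel: "j \<star> i = k \<star> i \<longleftrightarrow> j = k"
  by (metis assoc right_inverse right_neutral)

lemma lam_one_trivial:
  assumes "\<And>j. lam 1 j = j"
  shows "i \<star> j = i + j"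
proof -
  have "lam i j = j" for i
  proof (induction i rule: int_induct[of _ 0])
    case (step1 i)
    thus ?case using assms by (simp add: lam_add)
  next
    case (step2 i)
    thus ?case using assms by (metis diff_add_cancel lam_add lam_comm)
  qed simp
  thus ?thesis by (simp add: star_eq)
qed

end

locale comm_int_brace = int_brace +
  assumes star_comm: "a \<star> b = b \<star> a"
begin

text \<open>
  The homomorphism from \<open>(\<int>, +)\<close> to \<open>(\<int>, \<star>)\<close> that sends \<open>1\<close> to \<open>1\<close>, that is, the \<open>k\<close>-fold
  \<open>\<star>\<close>-multiple of \<open>1\<close>.
\<close>

definition multiple :: "int \<Rightarrow> int" where
  "multiple k = (if 0 \<le> k then ((\<star>) 1 ^^ nat k) 0 else iv (((\<star>) 1 ^^ nat (- k)) 0))"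

lemma star_left_comm: "a \<star> (b \<star> c) = b \<star> (a \<star> c)"
  by (metis assoc star_comm)

lemma inv_star: "iv (a \<star> b) = iv a \<star> iv b"
  by (metis inverse_distrib_swap star_comm)

lemma multiple_Suc: "multiple (k + 1) = 1 \<star> multiple k"
proof (cases "0 \<le> k")
  case True
  thus ?thesis by (simp add: multiple_def nat_add_distrib)
next
  case False
  define n where "n = nat (- k) - 1"
  have k: "k = - int (Suc n)" using False by (simp add: n_def)
  have "multiple k = iv 1 \<star> iv (((\<star>) 1 ^^ n) 0)"
    unfolding k by (simp add: multiple_def inv_star nat_add_distrib)
  moreover have "multiple (k + 1) = iv (((\<star>) 1 ^^ n) 0)"
    unfolding k by (cases n) (simp_all add: multiple_def nat_add_distrib)
  ultimately show ?thesis by (simp add: inv_cancel)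
qed

lemma multiple_zero [simp]: "multiple 0 = 0"
  by (simp add: multiple_def)

lemma multiple_hom:
  assumes "\<And>a b. h (a \<star> b) = h a \<star> h b" and "\<And>k :: int. H (k + 1) = h 1 \<star> H k" and "H 0 = 0"
  shows "h (multiple k) = H k"
proof (induction k rule: int_induct[of _ 0])
  case base
  have "h 0 \<star> h 0 = h 0 \<star> 0" using assms(1)[of 0 0] by simp
  hence "h 0 = 0" by (simp only: star_left_cancel)
  thus ?case using assms(3) by simp
next
  case (step1 i)
  thus ?case by (simp add: assms multiple_Suc)
next
  case (step2 i)
  have "h 1 \<star> h (multiple (i - 1)) = h 1 \<star> H (i - 1)"
    using step2 assms(1)[of 1 "multiple (i - 1)"] assms(2)[of "i - 1"] multiple_Suc[of "i - 1"]
    by simp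
  thus ?case by (simp add: star_left_cancel)
qed

lemma multiple_add: "multiple (a + b) = multiple a \<star> multiple b"
proof (induction b rule: int_induct[of _ 0])
  case (step1 i)
  thus ?case using multiple_Suc[of "a + i"] multiple_Suc[of i]
    by (simp add: star_left_comm add.assoc)
next
  case (step2 i)
  have "1 \<star> multiple (a + (i - 1)) = 1 \<star> (multiple a \<star> multiple (i - 1))"
    using step2 multiple_Suc[of "a + (i - 1)"] multiple_Suc[of "i - 1"]
    by (simp add: star_left_comm)
  thus ?case by (simp add: star_left_cancel)
qed simp

text \<open>
  The value at the vector \<open>1\<close> of the operator obtained by substituting \<open>lam 1\<close> into the polynomial, with
  \<open>\<star>\<close> as addition of vectors.
\<close>

definition ev :: "int poly \<Rightarrow> int" where
  "ev f = fold_coeffs (\<lambda>a y. multiple a \<star> lam 1 y) f 0"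

lemma ev_zero [simp]: "ev 0 = 0"
  by (simp add: ev_def)

lemma ev_pCons [simp]: "ev (pCons a f) = multiple a \<star> lam 1 (ev f)"
  by (cases "a = 0 \<and> f = 0") (auto simp: ev_def)

lemma multiple_one [simp]: "multiple 1 = 1"
  using multiple_Suc[of 0] by simp

lemma ev_add: "ev (f + g) = ev f \<star> ev g"
proof (induction f g rule: poly_induct2)
  case (pCons a f b g)
  thus ?case by (simp add: multiple_add lam_star assoc star_left_comm)
qed simp

lemma ev_minus: "ev (- f) = iv (ev f)"
proof -
  have "ev f \<star> ev (- f) = 0" using ev_add[of f "- f"] by simp
  thus ?thesis by (metis inverse_unique)
qed

lemma ev_smult_step: "ev (smult (k + 1) f) = ev f \<star> ev (smult k f)"
  by (simp add: smult_add_left ev_add star_comm)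

lemma ev_smult_cong: "ev f = ev g \<Longrightarrow> ev (smult k f) = ev (smult k g)"
proof (induction k rule: int_induct[of _ 0])
  case (step1 i)
  thus ?case by (simp add: ev_smult_step)
next
  case (step2 i)
  thus ?case using ev_smult_step[of "i - 1" f] ev_smult_step[of "i - 1" g]
    by (simp add: star_left_cancel)
qed simp

text \<open>
  The commutativity of \<open>+\<close> and of \<open>\<star>\<close> makes the product \<open>lam i j \<star> iv j\<close> symmetric in \<open>i\<close> and \<open>j\<close>.
  This is the step that turns the additive operators \<open>lam i\<close> into multiplications of a commutative ring.
\<close>

lemma lam_symmetric: "lam i j = j \<star> (lam j i \<star> iv i)"
proof -
  have "i \<star> lam i j = j \<star> lam j i" by (metis plus_eq add.commute)
  hence "lam i j = iv i \<star> (j \<star> lam j i)" by (metis inv_cancel(1))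
  thus ?thesis by (simp add: star_comm star_left_comm)
qed

text \<open>
  For \<open>g = 1\<close> this is the symmetry between \<open>lam (ev f) 1\<close> and \<open>lam 1 (ev f)\<close>. Both sides are additive
  in \<open>g\<close> and compatible with multiplication by \<open>t\<close>, which acts as \<open>lam 1\<close>. So \<open>lam (ev f)\<close> acts as
  multiplication by \<open>1 + u * f\<close> with \<open>u = t - 1\<close>.
\<close>

lemma lam_ev: "lam (ev f) (ev g) = ev (g + [:-1, 1:] * f * g)"
proof (induction g)
  case 0
  show ?case by simp
next
  case (pCons a g)
  have "lam (ev f) 1 = 1 \<star> (lam 1 (ev f) \<star> iv (ev f))" by (rule lam_symmetric)
  also have "\<dots> = ev (1 + (pCons 0 f - f))"
    by (simp add: ev_add ev_minus one_pCons diff_conv_add_uminus del: add_uminus_conv_diff)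
  finally have one: "lam (ev f) 1 = ev (1 + (pCons 0 f - f))" .
  have "lam (ev f) (multiple a) = ev (smult a (1 + (pCons 0 f - f)))"
    by (rule multiple_hom) (simp_all add: lam_star ev_smult_step one)
  moreover have "lam (ev f) (lam 1 (ev g)) = ev (pCons 0 (g + [:-1, 1:] * f * g))"
    using pCons.IH by (simp add: lam_comm[of "ev f" 1])
  ultimately have "lam (ev f) (ev (pCons a g))
      = ev (smult a (1 + (pCons 0 f - f)) + pCons 0 (g + [:-1, 1:] * f * g))"
    by (simp only: ev_pCons lam_star ev_add)
  also have "smult a (1 + (pCons 0 f - f)) + pCons 0 (g + [:-1, 1:] * f * g)
      = pCons a g + [:-1, 1:] * f * pCons a g"
    by (simp add: algebra_simps one_pCons smult_add_right smult_diff_right)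
  finally show ?case .
qed

lemma ev_mult_cong: "ev f = ev g \<Longrightarrow> ev (f * h) = ev (g * h)"
proof (induction h)
  case (pCons a h)
  thus ?case using ev_smult_cong[of f g a] by (simp add: ev_add)
qed simp

lemma poly_eq_sum_powers:
  fixes f :: "int poly"
  shows "\<exists>m (a :: nat \<Rightarrow> int). f = (\<Sum>i<m. of_int (a i) * [:0, 1:] ^ i)"
proof -
  have "f = (\<Sum>i\<le>degree f. of_int (Polynomial.coeff f i) * [:0, 1:] ^ i)"
    using poly_as_sum_of_monoms[of f] by (simp add: monom_altdef of_int_poly)
  thus ?thesis by (metis lessThan_Suc_atMost)
qed

lemma cyclic_circle: "cyclic_circle ev [:-1, 1:]"
proof
  have one: "1 + [:-1, 1:] = ([:0, 1:] :: int poly)" by (simp add: one_pCons)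
  show "ev 1 = 1" by (simp add: one_pCons)
  show "ev (f + g + [:-1, 1:] * f * g) = ev f + ev g" for f g
    using lam_ev[of f g] plus_eq[of "ev f" "ev g"] by (simp add: ev_add assoc)
  show "ev (f + h) = ev (g + h)" if "ev f = ev g" for f g h
    using that by (simp add: ev_add)
  show "ev (f * h) = ev (g * h)" if "ev f = ev g" for f g h
    using that by (rule ev_mult_cong)
  show "ev f = ev g" if "ev ((1 + [:-1, 1:]) * f) = ev ((1 + [:-1, 1:]) * g)" for f g
    using that unfolding one by (simp add: lam_inj)
  show "\<exists>m (a :: nat \<Rightarrow> int). f = (\<Sum>i<m. of_int (a i) * (1 + [:-1, 1:]) ^ i)" for f :: "int poly"
    unfolding one by (rule poly_eq_sum_powers)
qed

text \<open>
  The vanishing of \<open>u\<close> means \<open>lam 1 1 = 1\<close>. Hence \<open>j + 1 = j \<star> 1\<close> for all \<open>j\<close>, and comparing with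
  \<open>1 + j = 1 \<star> lam 1 j\<close> shows that \<open>lam 1\<close> is the identity.
\<close>

theorem star_eq_plus: "i \<star> j = i + j"
proof (rule lam_one_trivial)
  interpret cyclic_circle ev "[:-1, 1:]" by (rule cyclic_circle)
  have "multiple (- 1) \<star> lam 1 1 = 0" using E_u_eq_zero by simp
  moreover have "1 \<star> multiple (- 1) = 0" using multiple_Suc[of "- 1"] by simp
  ultimately have l: "lam 1 1 = 1" by (metis assoc left_neutral right_neutral)
  have "lam j 1 = 1" for j
  proof (induction j rule: int_induct[of _ 0])
    case (step1 i)
    thus ?case using l by (simp add: lam_add)
  next
    case (step2 i)
    thus ?case using l by (metis diff_add_cancel lam_add lam_comm lam_inj)
  qed simp
  thus "lam 1 j = j" for j
    by (metis plus_eq add.commute star_comm star_left_cancel)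
qed

end

section \<open>An abelian ideal, and the classification\<close>

context int_brace
begin

lemma lam_uminus: "lam i (- i) = iv i"
  by (simp add: lam_def)

lemma uminus_eq: "- i = lam (- i) (iv i)"
  by (metis lam_cancel(1) lam_uminus)

lemma lam_plus: "lam k (i + n) = lam k i + lam (k + i - lam k i) n"
proof -
  have "lam k (i + n) = lam k i \<star> lam (k + i) n"
    by (metis plus_eq lam_star lam_add)
  also have "\<dots> = lam k i + lam (k + i - lam k i) n"
    by (simp add: star_eq lam_add[symmetric])
  finally show ?thesis .
qed

text \<open>
  These elements measure how far \<open>lam\<close> is from being trivial. In the holomorph they generate the commutator
  subgroup of the product of the translations \<open>n \<mapsto> j + n\<close> and the automorphisms \<open>lam k\<close>.
\<close>

definition defects :: "int set" where
  "defects = {a \<star> iv (lam k a) | a k. True}"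

lemma defect_eq: "a \<star> iv (lam k a) = a + lam k (- a)"
  by (metis lam_comm lam_inv lam_uminus plus_eq)

lemma defects_lam: "x \<in> defects \<Longrightarrow> lam l x \<in> defects"
  unfolding defects_def using lam_comm by (auto simp: lam_star lam_inv) blast

lemma defects_inv: "x \<in> defects \<Longrightarrow> iv x \<in> defects"
proof -
  assume "x \<in> defects"
  then obtain a k where "x = a \<star> iv (lam k a)" unfolding defects_def by blast
  hence "iv x = lam k a \<star> iv (lam (- k) (lam k a))"
    by (simp add: inverse_distrib_swap)
  thus ?thesis unfolding defects_def by blast
qed

text \<open>
  Up to the automorphism \<open>lam j\<close>, the left-hand side is the \<open>\<star>\<close>-conjugate by \<open>j\<close> of the defect of
  \<open>a\<close> and \<open>k\<close>. It is again a defect of the same \<open>a\<close>, with a new second parameter that is independent of \<open>a\<close>. This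
  independence is what makes the operation commute with all \<open>lam l\<close>, which only change \<open>a\<close>.
\<close>

lemma defect_shift:
  "- j + (a + lam k (- a)) \<star> j = a + lam (k + lam (- k) j - j) (- a)"
proof -
  have "(a + lam k (- a)) \<star> j = a \<star> (iv (lam k a) \<star> j)"
    by (simp add: defect_eq[symmetric] assoc)
  also have "iv (lam k a) \<star> j = lam k (lam a (- a) \<star> lam (- k) j)"
    by (simp add: lam_star lam_uminus lam_inv)
  also have "lam a (- a) \<star> lam (- k) j = lam a (- a + lam (- k) j)"
    by (simp only: plus_eq[of "- a"] lam_star lam_cancel)
  also have "lam k \<dots> = lam a (lam k (- a + lam (- k) j))" by (rule lam_comm)
  also have "a \<star> \<dots> = a + lam k (lam (- k) j + (- a))"
    by (simp add: plus_eq[of a] add.commute)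
  also have "lam k (lam (- k) j + (- a)) = j + lam (k + lam (- k) j - j) (- a)"
    using lam_plus[of k "lam (- k) j" "- a"] by (simp only: lam_cancel)
  finally show ?thesis by (simp only: add.left_commute add_minus_cancel)
qed

lemma conj_eq: "iv j \<star> (x \<star> j) = lam j (- j + x \<star> j)"
  by (simp add: lam_def)

lemma defects_conj: "x \<in> defects \<Longrightarrow> iv j \<star> (x \<star> j) \<in> defects"
proof -
  assume "x \<in> defects"
  then obtain a k where x: "x = a + lam k (- a)" unfolding defects_def defect_eq by blast
  define q where "q = k + lam (- k) j - j"
  have "iv j \<star> (x \<star> j) = lam j (a \<star> iv (lam q a))"
    by (simp only: x conj_eq defect_shift defect_eq q_def)
  moreover have "a \<star> iv (lam q a) \<in> defects" unfolding defects_def by blast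
  ultimately show ?thesis by (simp only: defects_lam)
qed

text \<open>
  Let \<open>T\<close> be the map \<open>z \<mapsto> - j + z \<star> j\<close>. By \<open>defect_shift\<close>, \<open>T\<close> and \<open>lam l\<close> commute on
  defects. Since \<open>lam j \<circ> T\<close> is conjugation by \<open>j\<close>, the elements \<open>j\<close> and \<open>lam l j\<close> conjugate
  every defect \<open>y = lam l z\<close> in the same way, so \<open>j \<star> iv (lam l j)\<close> centralizes it.
\<close>

lemma defects_commute:
  assumes "x \<in> defects" "y \<in> defects"
  shows "x \<star> y = y \<star> x"
proof -
  obtain j l where x: "x = j \<star> iv (lam l j)" using assms(1) unfolding defects_def by blast
  have "lam (- l) y \<in> defects" using assms(2) by (rule defects_lam)
  then obtain a k where a: "lam (- l) y = a + lam k (- a)" unfolding defects_def defect_eq by blast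
  define z where "z = lam (- l) y"
  have y: "y = lam l z" by (simp add: z_def)
  have z: "z = a \<star> iv (lam k a)" using a by (simp add: z_def defect_eq)
  have "y = lam l a + lam k (- lam l a)"
    unfolding y z by (simp only: lam_star lam_inv lam_comm[of l k] defect_eq[symmetric])
  hence "- j + y \<star> j = lam l a + lam (k + lam (- k) j - j) (- lam l a)"
    using defect_shift[of j "lam l a" k] by (simp only:)
  also have "\<dots> = lam l (a \<star> iv (lam (k + lam (- k) j - j) a))"
    by (simp only: lam_star lam_inv lam_comm[of l "k + lam (- k) j - j"] defect_eq[symmetric])
  also have "\<dots> = lam l (- j + z \<star> j)"
    using defect_shift[of j a k] by (simp only: defect_eq a z_def)
  finally have "iv j \<star> (y \<star> j) = lam l (iv j \<star> (z \<star> j))"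
    by (simp add: conj_eq lam_comm[of l j])
  also have "\<dots> = iv (lam l j) \<star> (y \<star> lam l j)"
    by (simp add: lam_star lam_inv y)
  finally have "j \<star> (iv j \<star> (y \<star> j)) \<star> iv (lam l j) = j \<star> (iv (lam l j) \<star> (y \<star> lam l j)) \<star> iv (lam l j)"
    by simp
  thus ?thesis unfolding x by (simp add: assoc inv_cancel)
qed

text \<open>
  The subgroup of \<open>(\<int>, \<star>)\<close> generated by the defects. The rules mention no inverses because the inverse
  of a defect is a defect.
\<close>

inductive_set D :: "int set" where
  zero: "0 \<in> D"
| step: "x \<in> defects \<Longrightarrow> y \<in> D \<Longrightarrow> x \<star> y \<in> D"

lemma defects_D: "x \<in> defects \<Longrightarrow> x \<in> D"
  using D.step[OF _ D.zero, of x] by simp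

lemma D_star: "x \<in> D \<Longrightarrow> y \<in> D \<Longrightarrow> x \<star> y \<in> D"
  by (induction rule: D.induct) (simp_all add: assoc D.step)

lemma D_inv: "x \<in> D \<Longrightarrow> iv x \<in> D"
proof (induction rule: D.induct)
  case zero
  have "iv 0 = 0" by (rule inverse_unique) simp
  thus ?case by (simp add: D.zero)
next
  case (step x y)
  thus ?case by (simp add: inverse_distrib_swap D_star defects_D defects_inv)
qed

lemma D_lam: "x \<in> D \<Longrightarrow> lam l x \<in> D"
  by (induction rule: D.induct) (simp_all add: lam_star D.intros defects_lam)

lemma D_conj: "x \<in> D \<Longrightarrow> iv j \<star> (x \<star> j) \<in> D"
proof (induction rule: D.induct)
  case zero
  show ?case by (simp add: D.zero)
next
  case (step x y)
  have "(iv j \<star> (x \<star> j)) \<star> (iv j \<star> (y \<star> j)) \<in> D"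
    by (rule D.step[OF defects_conj[OF step(1)] step(3)])
  thus ?case by (simp add: assoc inv_cancel)
qed

lemma D_comm: "x \<in> D \<Longrightarrow> y \<in> D \<Longrightarrow> x \<star> y = y \<star> x"
proof (induction rule: D.induct)
  case (step x z)
  have "x \<star> y = y \<star> x"
    using \<open>y \<in> D\<close>
  proof (induction rule: D.induct)
    case (step w y)
    thus ?case using defects_commute[OF \<open>x \<in> defects\<close>] by (metis assoc)
  qed simp
  thus ?case using step by (metis assoc)
qed simp

lemma D_lam_diff: "iv j \<star> lam k j \<in> D"
proof -
  have "iv j \<star> iv (lam k (iv j)) \<in> defects" unfolding defects_def by blast
  thus ?thesis by (simp add: lam_inv defects_D)
qed

lemma D_plus: "x \<in> D \<Longrightarrow> y \<in> D \<Longrightarrow> x + y \<in> D"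
  by (simp add: plus_eq D_star D_lam)

lemma D_uminus: "x \<in> D \<Longrightarrow> - x \<in> D"
  by (subst uminus_eq) (simp add: D_lam D_inv)

text \<open>
  Since \<open>D\<close> is closed under \<open>+\<close>, it is \<open>d\<int>\<close>, and division by \<open>d\<close> turns the restriction of \<open>\<star>\<close> to \<open>D\<close>
  into a commutative brace operation on \<open>\<int>\<close>.
\<close>

lemma D_star_eq_plus:
  assumes "x \<in> D" "y \<in> D"
  shows "x \<star> y = x + y"
proof -
  obtain d where d: "d \<ge> 0" "D = {n. d dvd n}"
    using int_subgroup_principal[of D] D.zero D_plus D_uminus by blast
  show ?thesis
  proof (cases "d = 0")
    case True
    thus ?thesis using assms d by simp
  next
    case False
    define st where "st i j = ((d * i) \<star> (d * j)) div d" for i j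
    define inv' where "inv' i = iv (d * i) div d" for i
    have st: "d * st i j = (d * i) \<star> (d * j)" for i j
      using D_star[of "d * i" "d * j"] by (simp add: st_def d)
    have inv': "d * inv' i = iv (d * i)" for i
      using D_inv[of "d * i"] by (simp add: inv'_def d)
    have cancel: "i = j" if "d * i = d * j" for i j
      using that False by simp
    interpret R: comm_int_brace st inv'
    proof
      show "st (st i j) k = st i (st j k)" for i j k
        by (rule cancel) (simp add: st assoc)
      show "st 0 i = i" for i
        by (rule cancel) (simp add: st)
      show "st (inv' i) i = 0" for i
        by (rule cancel) (simp add: st inv')
      show "i + st j k = st (st (i + j) (inv' i)) (i + k)" for i j k
        by (rule cancel) (simp add: st inv' brace distrib_left)
      show "st i j = st j i" for i j
        by (rule cancel) (simp add: st D_comm d)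
    qed
    obtain i j where ij: "x = d * i" "y = d * j" using assms d by (auto elim!: dvdE)
    have "x \<star> y = d * st i j" by (simp add: st ij)
    also have "\<dots> = x + y" by (simp add: R.star_eq_plus ij distrib_left)
    finally show ?thesis .
  qed
qed

lemma D_inv_eq: "x \<in> D \<Longrightarrow> iv x = - x"
  using D_star_eq_plus[OF _ D_inv, of x x] by simp

text \<open>
  Modulo \<open>D\<close> the action \<open>lam\<close> is trivial, so \<open>n + 1 = n \<star> lam n 1\<close> differs from \<open>n \<star> 1\<close> by an element
  of \<open>D\<close>: the group \<open>(\<int>, \<star>)\<close> is generated by \<open>1\<close> and \<open>D\<close>.
\<close>

lemma generation:
  assumes "\<And>m n. P m \<Longrightarrow> P n \<Longrightarrow> P (m \<star> n)" "\<And>n. P n \<Longrightarrow> P (iv n)" "P 1" "\<And>x. x \<in> D \<Longrightarrow> P x"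
  shows "P n"
proof -
  have l: "P (lam n 1)" for n
    using assms(1)[OF assms(3) assms(4)[OF D_lam_diff[of 1 n]]] by (simp add: inv_cancel)
  show ?thesis
  proof (induction n rule: int_induct[of _ 0])
    case base
    show ?case by (rule assms(4)[OF D.zero])
  next
    case (step1 i)
    thus ?case using assms(1)[OF step1(2) l] by (simp add: plus_eq)
  next
    case (step2 i)
    have "i = (i - 1) \<star> lam (i - 1) 1" by (simp add: plus_eq[symmetric])
    hence "i \<star> iv (lam (i - 1) 1) = i - 1" by (metis assoc right_inverse right_neutral)
    thus ?case using assms(1)[OF step2(2) assms(2)[OF l]] by metis
  qed
qed

lemma commuting_imp_plus:
  assumes "\<And>x. x \<in> D \<Longrightarrow> 1 \<star> x = x \<star> 1"
  shows "i \<star> j = i + j"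
proof -
  have inv_commute: "iv n \<star> x = x \<star> iv n" if "n \<star> x = x \<star> n" for n x
    using that by (metis assoc inv_cancel left_inverse right_inverse right_neutral)
  \<comment> \<open>First \<open>1\<close> and \<open>D\<close> are central; then the centre contains a generating set.\<close>
  have 1: "n \<star> 1 = 1 \<star> n \<and> (\<forall>x\<in>D. n \<star> x = x \<star> n)" for n
    by (rule generation[of "\<lambda>n. n \<star> 1 = 1 \<star> n \<and> (\<forall>x\<in>D. n \<star> x = x \<star> n)"])
      (use assms D_comm inv_commute in \<open>metis assoc\<close>)+
  have 2: "\<forall>n. m \<star> n = n \<star> m" for m
    by (rule generation[of "\<lambda>m. \<forall>n. m \<star> n = n \<star> m"])
      (use 1 inv_commute in \<open>metis assoc\<close>)+
  interpret comm_int_brace star iv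
    by unfold_locales (use 2 in blast)
  show ?thesis by (rule star_eq_plus)
qed


text \<open>
  Addition and \<open>\<star>\<close> agree on \<open>D\<close>, so \<open>h\<close> is additive on \<open>d\<int>\<close>.
\<close>

lemma D_multiples:
  assumes D: "D = {n. d dvd n}"
    and h: "\<And>x y. h (x \<star> y) = h x \<star> h y" "\<And>x. x \<in> D \<Longrightarrow> h x \<in> D"
  shows "h (d * k) = h d * k"
proof -
  have dD: "d * k \<in> D" for k by (simp add: D)
  have hd: "h d * k \<in> D" for k using h(2)[of d] by (simp add: D)
  show ?thesis
  proof (induction k rule: int_induct[of _ 0])
    case base
    have "h 0 + h 0 = h 0"
      using h(1)[of 0 0] D_star_eq_plus[OF h(2) h(2), OF D.zero D.zero] by simp
    thus ?case by simp
  next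
    case (step1 i)
    have "h (d * i + d) = h (d * i) + h d"
      using h(1)[of "d * i" d] D_star_eq_plus[OF h(2) h(2), of "d * i" d]
        D_star_eq_plus[of "d * i" d] dD[of i] dD[of 1] by simp
    thus ?case using step1 by (simp add: algebra_simps)
  next
    case (step2 i)
    have "h (d * (i - 1) + d) = h (d * (i - 1)) + h d"
      using h(1)[of "d * (i - 1)" d] D_star_eq_plus[OF h(2) h(2), of "d * (i - 1)" d]
        D_star_eq_plus[of "d * (i - 1)" d] dD[of "i - 1"] dD[of 1] by simp
    thus ?case using step2 by (simp add: algebra_simps)
  qed
qed

lemma D_automorphism_sign:
  assumes h: "\<And>x y. h (x \<star> y) = h x \<star> h y" "\<And>x. x \<in> D \<Longrightarrow> h x \<in> D"
    and g: "\<And>x y. g (x \<star> y) = g x \<star> g y" "\<And>x. x \<in> D \<Longrightarrow> g x \<in> D"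
    and inv: "\<And>x. g (h x) = x"
  shows "(\<forall>x\<in>D. h x = x) \<or> (\<forall>x\<in>D. h x = - x)"
proof -
  obtain d where d: "d \<ge> 0" "D = {n. d dvd n}"
    using int_subgroup_principal[of D] D.zero D_plus D_uminus by blast
  obtain a where a: "h d = d * a" using h(2)[of d] by (auto simp: d elim: dvdE)
  obtain b where b: "g d = d * b" using g(2)[of d] by (auto simp: d elim: dvdE)
  have h': "h (d * k) = d * k * a" for k
    using D_multiples[OF d(2) h, of k] a by simp
  have g': "g (d * k) = d * k * b" for k
    using D_multiples[OF d(2) g, of k] b by simp
  have "d * (a * b) = d" using inv[of d] by (simp add: a g' mult.assoc)
  hence "d = 0 \<or> a * b = 1" by simp
  hence "d = 0 \<or> a = 1 \<or> a = - 1" using pos_zmult_eq_1_iff_lemma by blast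
  thus ?thesis using h' by (auto simp: d elim!: dvdE)
qed

text \<open>
  If \<open>lam 2\<close> fixes \<open>2\<close>, then \<open>2 * b + 2 = 2 * b \<star> 2\<close>. So \<open>2\<close> generates the even integers also for \<open>\<star>\<close>,
  and \<open>lam\<close> of an even integer fixes them all.
\<close>

lemma even_plus:
  assumes "lam 2 2 = 2" "even x" "even y"
  shows "lam x y = y" "x \<star> y = x + y"
proof -
  have two: "lam (2 * k) 2 = 2" for k
  proof (induction k rule: int_induct[of _ 0])
    case (step1 i)
    have "lam (2 * i + 2) 2 = 2" using step1 assms(1) by (simp only: lam_add)
    thus ?case by (simp add: algebra_simps)
  next
    case (step2 i)
    have "lam (2 * (i - 1) + 2) 2 = lam (2 * (i - 1)) 2" using assms(1) by (simp only: lam_add)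
    thus ?case using step2 by (simp add: algebra_simps)
  qed simp
  have step: "2 * b \<star> 2 = 2 * b + 2" for b by (simp add: star_eq two[of "- b", simplified])
  have even: "lam (2 * a) (2 * b) = 2 * b" for a b
  proof (induction b rule: int_induct[of _ 0])
    case (step1 i)
    have "2 * (i + 1) = 2 * i \<star> 2" by (simp add: step)
    thus ?case using step1 two by (simp only: lam_star)
  next
    case (step2 i)
    have "lam (2 * a) (2 * (i - 1)) \<star> 2 = lam (2 * a) (2 * (i - 1) \<star> 2)"
      using two by (simp only: lam_star)
    also have "\<dots> = 2 * (i - 1) \<star> 2" using step2 step[of "i - 1"] by simp
    finally show ?case by (simp only: star_right_cancel)
  qed simp
  show "lam x y = y" using even assms by (auto elim!: evenE)
  show "x \<star> y = x + y" using even[of "- (x div 2)" "y div 2"] assms by (simp add: star_eq)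
qed

text \<open>
  Let \<open>lam 1 1 = 1 \<star> y\<close> with \<open>y \<in> D\<close>. Conjugation by \<open>n\<close> acts on \<open>D\<close> by the sign \<open>(- 1)\<^sup>n\<close>, and \<open>d\<close>
  commutes with itself, so \<open>d\<close> is even. Further \<open>2 = 1 \<star> 1 \<star> y\<close> is fixed by \<open>lam 2\<close>, so the even
  integers form a cyclic group for \<open>\<star>\<close> that contains \<open>d\<close>. Conjugation by \<open>1\<close> maps \<open>2\<close> to
  \<open>2 - 2 * y\<close>, thus multiplies even integers by \<open>1 - y\<close>. On \<open>D\<close> this factor is \<open>- 1\<close>, which gives \<open>y = 2\<close>.
\<close>

lemma inverting_imp_two:
  assumes inverts: "\<forall>x\<in>D. 1 \<star> x = - x \<star> 1"
    and D: "D = {n. d dvd n}" and "d > 0"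
    and sign: "(\<forall>x\<in>D. lam 1 x = x) \<or> (\<forall>x\<in>D. lam 1 x = - x)"
  shows "d = 2" "lam 1 1 = 1 \<star> 2" "lam 2 2 = 2"
proof -
  have neg: "1 \<star> x = - x \<star> 1" if "x \<in> D" for x
    using inverts that by blast
  have parity: "(even n \<longrightarrow> (\<forall>x\<in>D. n \<star> x = x \<star> n)) \<and> (odd n \<longrightarrow> (\<forall>x\<in>D. n \<star> x = - x \<star> n))" for n
  proof -
    have shift: "(m + 1) \<star> x = (m \<star> - x) \<star> lam m 1" if x: "x \<in> D" for m x
    proof -
      define z where "z = iv 1 \<star> lam m 1"
      have z: "z \<in> D" unfolding z_def by (rule D_lam_diff)
      have l: "lam m 1 = 1 \<star> z" by (simp add: z_def inv_cancel)
      have "(m + 1) \<star> x = m \<star> ((1 \<star> x) \<star> z)"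
        unfolding plus_eq[of m 1] l using D_comm[OF z x] by (simp add: assoc)
      thus ?thesis using neg[OF x] by (simp add: l assoc)
    qed
    show ?thesis
    proof (induction n rule: int_induct[of _ 0])
      case (step1 i)
      have "(i + 1) \<star> x = (if even i then - x else x) \<star> (i + 1)" if "x \<in> D" for x
      proof -
        have "i \<star> - x = (if even i then - x else x) \<star> i"
          using step1(2) D_uminus[OF that] by simp
        thus ?thesis by (simp only: shift[OF that, of i] assoc plus_eq[of i 1, symmetric])
      qed
      thus ?case by auto
    next
      case (step2 i)
      have "(i - 1) \<star> x = (if even i then - x else x) \<star> (i - 1)" if "x \<in> D" for x
      proof -
        have i: "(i - 1) \<star> lam (i - 1) 1 = i" using plus_eq[of "i - 1" 1] by simp
        have "((i - 1) \<star> x) \<star> lam (i - 1) 1 = i \<star> - x"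
          using shift[OF D_uminus[OF that], of "i - 1"] by (simp only: diff_add_cancel minus_minus)
        also have "\<dots> = (if even i then - x else x) \<star> i"
          using step2(2) D_uminus[OF that] by simp
        also have "\<dots> = ((if even i then - x else x) \<star> (i - 1)) \<star> lam (i - 1) 1"
          by (simp only: assoc i)
        finally show ?thesis by (simp only: star_right_cancel)
      qed
      thus ?case by auto
    qed simp
  qed
  have dD: "d \<in> D" by (simp add: D)
  have even_d: "even d"
  proof (rule ccontr)
    assume "odd d"
    hence "d \<star> d = - d \<star> d" using parity[of d] dD by simp
    hence "d = - d" by (simp only: star_right_cancel)
    thus False using \<open>d > 0\<close> by simp
  qed
  define y where "y = iv 1 \<star> lam 1 1"
  have y: "y \<in> D" unfolding y_def by (rule D_lam_diff)
  have lam1: "lam 1 1 = 1 \<star> y" by (simp add: y_def inv_cancel)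
  have two: "2 = 1 \<star> (1 \<star> y)" using plus_eq[of 1 1] lam1 by simp
  have "lam 2 y = y"
    using sign y lam_add[of 1 1 y] D_uminus[OF y] by fastforce
  moreover have "lam 2 1 = 1 \<star> (y \<star> lam 1 y)"
    using lam_add[of 1 1 1] by (simp add: lam1 lam_star assoc)
  moreover define w where "w = y \<star> lam 1 y"
  moreover have w: "w \<in> D" unfolding w_def by (intro D_star D_lam y)
  ultimately have "lam 2 2 = (1 \<star> w) \<star> (1 \<star> w) \<star> y"
    by (subst (2) two) (simp add: lam_star assoc)
  also have "1 \<star> w \<star> (1 \<star> w) = 1 \<star> 1"
    using neg[OF w] D_inv_eq[OF w] by (metis assoc inv_cancel(2) neg w D_uminus minus_minus right_neutral right_inverse)
  finally show two2: "lam 2 2 = 2" using two by (simp add: assoc)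
  have conj: "1 \<star> 2 = (2 - 2 * y) \<star> 1"
  proof -
    have two_star: "1 \<star> (1 \<star> (y \<star> z)) = 2 \<star> z" for z
      unfolding two by (simp only: assoc)
    have "1 \<star> 2 = 1 \<star> (1 \<star> (1 \<star> y))" using two by (rule arg_cong)
    also have "\<dots> = 1 \<star> (1 \<star> ((1 \<star> - y) \<star> (y \<star> y)))"
      using D_inv_eq[OF y] by (simp add: assoc inv_cancel flip: D_inv_eq[OF y])
    also have "1 \<star> - y = y \<star> 1" using neg[OF D_uminus[OF y]] by simp
    also have "y \<star> y = 2 * y" using D_star_eq_plus[OF y y] by simp
    also have "1 \<star> (1 \<star> ((y \<star> 1) \<star> (2 * y))) = 2 \<star> (1 \<star> (2 * y))"
      by (simp only: assoc two_star)
    also have "1 \<star> (2 * y) = - (2 * y) \<star> 1"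
      using neg[OF D_plus[OF y y]] by simp
    also have "2 \<star> (- (2 * y) \<star> 1) = (2 - 2 * y) \<star> 1"
    proof -
      have "2 \<star> - (2 * y) = 2 + - (2 * y)" by (rule even_plus(2)[OF two2]) simp_all
      thus ?thesis by (simp only: assoc[symmetric]) simp
    qed
    finally show ?thesis .
  qed
  have plus2: "a \<star> b = a + b" if "even a" "even b" for a b
    using that by (rule even_plus(2)[OF two2])
  have conj2: "1 \<star> (2 * b) = (2 * b - 2 * y * b) \<star> 1" for b
  proof (induction b rule: int_induct[of _ 0])
    case (step1 i)
    have "1 \<star> (2 * (i + 1)) = (1 \<star> (2 * i)) \<star> 2"
      using plus2[of "2 * i" 2] by (simp only: assoc) (simp add: distrib_left)
    also have "\<dots> = (2 * i - 2 * y * i) \<star> (1 \<star> 2)" by (simp only: step1(2) assoc)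
    also have "\<dots> = ((2 * i - 2 * y * i) \<star> (2 - 2 * y)) \<star> 1" by (simp only: conj assoc)
    also have "(2 * i - 2 * y * i) \<star> (2 - 2 * y) = (2 * i - 2 * y * i) + (2 - 2 * y)"
      by (rule plus2) simp_all
    also have "\<dots> = 2 * (i + 1) - 2 * y * (i + 1)" by (simp add: algebra_simps)
    finally show ?case .
  next
    case (step2 i)
    define c where "c = 2 * (i - 1) - 2 * y * (i - 1)"
    have "(c \<star> 1) \<star> 2 = (c \<star> (2 - 2 * y)) \<star> 1"
      by (simp only: conj assoc)
    also have "c \<star> (2 - 2 * y) = c + (2 - 2 * y)"
      by (rule plus2) (simp_all add: c_def)
    also have "\<dots> = 2 * i - 2 * y * i" by (simp add: c_def algebra_simps)
    also have "\<dots> \<star> 1 = 1 \<star> (2 * i)" using step2(2) by (rule sym)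
    also have "2 * i = 2 * (i - 1) + 2" by simp
    also have "\<dots> = 2 * (i - 1) \<star> 2" by (rule plus2[symmetric]) simp_all
    finally have "(c \<star> 1) \<star> 2 = (1 \<star> (2 * (i - 1))) \<star> 2" by (simp only: assoc)
    thus ?case unfolding c_def by (simp only: star_right_cancel)
  qed simp
  obtain e where e: "d = 2 * e" using even_d by (rule evenE)
  have "(d - y * d) \<star> 1 = - d \<star> 1"
  proof -
    have "d - y * d = 2 * e - 2 * y * e" by (simp add: e)
    thus ?thesis using conj2[of e] neg[OF dD] by (simp only: e)
  qed
  hence "d - y * d = - d" by (simp only: star_right_cancel)
  hence "d * (2 - y) = 0" by (simp add: algebra_simps)
  hence y2: "y = 2" using \<open>d > 0\<close> by simp
  thus "lam 1 1 = 1 \<star> 2" by (simp add: lam1)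
  have "d dvd 2" using y by (simp add: D y2)
  hence "d \<le> 2" by (rule zdvd_imp_le) simp
  thus "d = 2" using e \<open>d > 0\<close> by presburger
qed

text \<open>
  In the nonabelian case \<open>D = 2\<int>\<close> and \<open>lam 1 1 = 1 + lam 1 2\<close>. If \<open>lam 1\<close> fixes \<open>D\<close>, it fixes even
  integers and adds \<open>2\<close> to odd ones. If it inverts \<open>D\<close>, it is negation. Then \<open>i \<star> j = i + lam (- i) j\<close>
  gives the two formulas.
\<close>

theorem classification:
  "(\<forall>i j. i \<star> j = i + j)
    \<or> (\<forall>i j. i \<star> j = i + (- 1) ^ nat \<bar>i\<bar> * j)
    \<or> (\<forall>i j. i \<star> j = j + (- 1) ^ nat \<bar>j\<bar> * i)"
proof -
  obtain d where d: "d \<ge> 0" "D = {n. d dvd n}"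
    using int_subgroup_principal[of D] D.zero D_plus D_uminus by blast
  show ?thesis
  proof (cases "d = 0")
    case True
    have "lam k j = j" for k j
    proof -
      have "iv j \<star> lam k j = 0" using D_lam_diff[of j k] by (simp add: d True)
      hence "j \<star> (iv j \<star> lam k j) = j" by simp
      thus ?thesis by (simp only: inv_cancel)
    qed
    thus ?thesis using lam_one_trivial by blast
  next
    case False
    hence "d > 0" using d by simp
    have sign: "(\<forall>x\<in>D. lam 1 x = x) \<or> (\<forall>x\<in>D. lam 1 x = - x)"
      by (rule D_automorphism_sign[of "lam 1" "lam (- 1)"]) (auto simp: lam_star D_lam)
    have "(\<forall>x\<in>D. 1 \<star> x \<star> iv 1 = x) \<or> (\<forall>x\<in>D. 1 \<star> x \<star> iv 1 = - x)"
    proof (rule D_automorphism_sign[of "\<lambda>x. 1 \<star> x \<star> iv 1" "\<lambda>x. iv 1 \<star> x \<star> 1"])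
      show "1 \<star> x \<star> iv 1 \<in> D" if "x \<in> D" for x
        using D_conj[OF that, of "iv 1"] by (simp add: assoc)
      show "iv 1 \<star> x \<star> 1 \<in> D" if "x \<in> D" for x
        using D_conj[OF that, of 1] by (simp add: assoc)
    qed (auto simp: assoc inv_cancel)
    thus ?thesis
    proof
      assume "\<forall>x\<in>D. 1 \<star> x \<star> iv 1 = x"
      moreover have "1 \<star> x = (1 \<star> x \<star> iv 1) \<star> 1" for x by (simp add: assoc)
      ultimately have "1 \<star> x = x \<star> 1" if "x \<in> D" for x using that by metis
      thus ?thesis using commuting_imp_plus by blast
    next
      assume "\<forall>x\<in>D. 1 \<star> x \<star> iv 1 = - x"
      moreover have "1 \<star> x = (1 \<star> x \<star> iv 1) \<star> 1" for x by (simp add: assoc)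
      ultimately have neg: "\<forall>x\<in>D. 1 \<star> x = - x \<star> 1" by metis
      note two = inverting_imp_two[OF neg d(2) \<open>d > 0\<close> sign]
      have D: "x \<in> D \<longleftrightarrow> even x" for x by (simp add: d two(1))
      have lam_even: "lam n x = (if even n then x else lam 1 x)" if "even x" for n x
      proof (cases "even n")
        case False
        hence "lam (1 + (n - 1)) x = lam 1 (lam (n - 1) x)" by (simp only: lam_add)
        thus ?thesis using False that even_plus(1)[OF two(3), of "n - 1" x] by simp
      qed (simp add: that even_plus(1)[OF two(3)])
      have m2: "lam (- 1) 2 = lam 1 2" using lam_even[of 2 "- 1"] by simp
      have lam1: "lam 1 1 = 1 + lam 1 2" using two(2) by (simp add: star_eq m2)
      from sign show ?thesis
      proof
        assume s: "\<forall>x\<in>D. lam 1 x = x"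
        hence ev: "lam 1 x = x" if "even x" for x using that D by blast
        have odd: "lam 1 y = y + 2" if "odd y" for y
          using lam_plus[of 1 1 "y - 1"] lam_even[of "y - 1" "1 + 1 - lam 1 1"] ev[of "y - 1"] ev[of 2] that
          by (simp add: lam1)
        have k: "lam k j = (if even j then j else j + 2 * k)" for k j
        proof (induction k rule: int_induct[of _ 0])
          case (step1 i)
          have "lam (i + 1) j = lam 1 (lam i j)" by (simp only: lam_add lam_comm[of i])
          thus ?case using step1 ev odd by simp
        next
          case (step2 i)
          have "lam 1 (lam (i - 1) j) = lam i j" by (simp flip: lam_add)
          also have "\<dots> = lam 1 (if even j then j else j + 2 * (i - 1))"
            using step2 ev odd by simp
          finally show ?case by (simp only: lam_inj)
        qed simp
        have "i \<star> j = j + (- 1) ^ nat \<bar>j\<bar> * i" for i j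
          by (cases "even j") (simp_all add: star_eq k even_nat_iff)
        thus ?thesis by blast
      next
        assume s: "\<forall>x\<in>D. lam 1 x = - x"
        hence ev: "lam 1 x = - x" if "even x" for x using that D by blast
        have odd: "lam 1 y = - y" if "odd y" for y
          using lam_plus[of 1 1 "y - 1"] lam_even[of "y - 1" "1 + 1 - lam 1 1"] ev[of "y - 1"] ev[of 2] that
          by (simp add: lam1)
        have one: "lam 1 j = - j" for j using ev odd by blast
        have k: "lam k j = (if even k then j else - j)" for k j
        proof (induction k rule: int_induct[of _ 0])
          case (step1 i)
          have "lam (i + 1) j = lam 1 (lam i j)" by (simp only: lam_add lam_comm[of i])
          thus ?case using step1 one by simp
        next
          case (step2 i)
          have "lam 1 (lam (i - 1) j) = lam i j" by (simp flip: lam_add)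
          thus ?case using step2 one by (auto split: if_splits)
        qed simp
        have "i \<star> j = i + (- 1) ^ nat \<bar>i\<bar> * j" for i j
          by (cases "even i") (simp_all add: star_eq k even_nat_iff)
        thus ?thesis by blast
      qed
    qed
  qed
qed

end

section \<open>Transfer to abstract skew braces\<close>

theorem theorem4p6:
  fixes G :: "('a, 'b) monoid_scheme" and M :: "('a, 'c) monoid_scheme" and x :: 'a
  assumes "skew_brace G M"
    and "x \<in> carrier M"
    and "carrier M = {x [^]\<^bsub>M\<^esub> i | i :: int. True}"
    and "infinite (carrier M)"
  shows "(\<forall>i j :: int. x [^]\<^bsub>M\<^esub> i \<otimes>\<^bsub>G\<^esub> x [^]\<^bsub>M\<^esub> j = x [^]\<^bsub>M\<^esub> (i + j))
    \<or> (\<forall>i j :: int. x [^]\<^bsub>M\<^esub> i \<otimes>\<^bsub>G\<^esub> x [^]\<^bsub>M\<^esub> j = x [^]\<^bsub>M\<^esub> (i + (- 1) ^ nat \<bar>i\<bar> * j))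
    \<or> (\<forall>i j :: int. x [^]\<^bsub>M\<^esub> i \<otimes>\<^bsub>G\<^esub> x [^]\<^bsub>M\<^esub> j = x [^]\<^bsub>M\<^esub> (j + (- 1) ^ nat \<bar>j\<bar> * i))"
proof -
  interpret skew_brace G M by (rule assms(1))
  define p where "p i = x [^]\<^bsub>M\<^esub> i" for i :: int
  have carrier: "carrier G = range p"
    using assms(3) same_carrier by (auto simp: p_def)
  have pG: "p i \<in> carrier G" for i using carrier by blast
  have range: "\<exists>i. a = p i" if "a \<in> carrier G" for a
    using that carrier by blast
  have p_add: "p (i + j) = p i \<otimes>\<^bsub>M\<^esub> p j" for i j
    unfolding p_def using assms(2) by (rule multiplicative.int_pow_mult)
  have inj: "inj p"
  proof -
    have "carrier (subgroup_generated M {x}) = carrier M"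
      using multiplicative.generate_pow[OF assms(2)] assms(2,3)
      by (auto simp: carrier_subgroup_generated)
    thus ?thesis
      using multiplicative.infinite_cyclic_subgroup_int[OF assms(2)] assms(4)
      by (auto simp: p_def inj_def)
  qed
  define star where "star i j = inv_into UNIV p (p i \<otimes>\<^bsub>G\<^esub> p j)" for i j
  define iv where "iv i = inv_into UNIV p (inv\<^bsub>G\<^esub> (p i))" for i
  have p_star: "p (star i j) = p i \<otimes>\<^bsub>G\<^esub> p j" for i j
    unfolding star_def using pG carrier by (intro f_inv_into_f) (metis additive.m_closed)
  have p_iv: "p (iv i) = inv\<^bsub>G\<^esub> (p i)" for i
    unfolding iv_def using pG carrier by (intro f_inv_into_f) (metis additive.inv_closed)
  \<comment> \<open>The brace identity with \<open>b = c = \<one>\<close> forces the two neutral elements to coincide.\<close>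
  have p0: "p 0 = \<one>\<^bsub>G\<^esub>"
  proof -
    have "p 0 \<otimes>\<^bsub>M\<^esub> (\<one>\<^bsub>G\<^esub> \<otimes>\<^bsub>G\<^esub> \<one>\<^bsub>G\<^esub>) = p 0 \<otimes>\<^bsub>M\<^esub> \<one>\<^bsub>G\<^esub> \<otimes>\<^bsub>G\<^esub> inv\<^bsub>G\<^esub> (p 0) \<otimes>\<^bsub>G\<^esub> (p 0 \<otimes>\<^bsub>M\<^esub> \<one>\<^bsub>G\<^esub>)"
      by (rule brace_identity) (simp_all add: pG)
    moreover have "p 0 \<otimes>\<^bsub>M\<^esub> \<one>\<^bsub>G\<^esub> = \<one>\<^bsub>G\<^esub>"
      using same_carrier by (simp add: p_def flip: same_carrier)
    ultimately have "inv\<^bsub>G\<^esub> (p 0) = \<one>\<^bsub>G\<^esub>" using pG[of 0] by simp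
    thus ?thesis using pG[of 0] additive.inv_inv additive.inv_one by metis
  qed
  interpret int_brace star iv
  proof
    show "star (star i j) k = star i (star j k)" for i j k
      by (rule injD[OF inj]) (simp add: p_star additive.m_assoc pG)
    show "star 0 i = i" for i
      by (rule injD[OF inj]) (simp add: p_star p0 pG)
    show "star (iv i) i = 0" for i
      by (rule injD[OF inj]) (simp add: p_star p_iv p0 pG)
    show "i + star j k = star (star (i + j) (iv i)) (i + k)" for i j k
      by (rule injD[OF inj]) (simp add: p_star p_iv p_add pG brace_identity)
  qed
  show ?thesis
    using classification unfolding p_def[symmetric] p_star[symmetric] by metis
qed

end
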